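(* Let $I$ be an interpolating Blaschke product with zeros $\Lambda=\{\lambda_n\}_{n\ge1}$, and let $h\in H^2$ be such that the truncated Toeplitz operator $A_{\overline{h}}$ is bounded on $K_I$. Let $\zeta\in\mathbb{T}$. Then every function in $\operatorname{Rng}A_{\overline{h}}$ has a finite non-tangential limit at $\zeta$ if and only if $$\sum_{n\ge1}(1-|\lambda_n|^2)\left|\frac{h(\lambda_n)}{\zeta-\lambda_n}\right|^2<\infty .$$
   Context: $\mathbb{D}$ is the open unit disk, $\mathbb{T}$ the unit circle, $H^2$ the Hardy space of $\mathbb{D}$ (viewed inside $L^2(\mathbb{T},d\theta/2\pi)$ via boundary values). For an inner function $I$, $K_I=H^2\ominus IH^2$ and $P_I$ is the orthogonal projection of $L^2$ onto $K_I$. For $h\in H^2$, $A_{\overline{h}}f=P_I(\overline{h}f)$, initially defined on the dense set of bounded functions in $K_I$; "bounded" means it extends to a bounded operator on $K_I$, and $\operatorname{Rng}A_{\overline{h}}$ is the range of this extension. An interpolating Blaschke product is a Blaschke product whose zero sequence $\{\lambda_n\}$ (distinct points) satisfies $\inf_n\prod_{k\ne n}\left|\frac{\lambda_n-\lambda_k}{1-\overline{\lambda_k}\lambda_n}\right|>0$. *)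

theory Defs
  imports "HOL-Complex_Analysis.Complex_Analysis"
begin

text \<open>Functions on the disk are modelled as complex functions holomorphic on the
open unit disk. The Hardy space H^2 is identified (via Parseval) with the
holomorphic functions whose Taylor coefficients at 0 are square summable; the
inner product of H^2 (= that of L^2 of the circle restricted to boundary values)
is the l^2 inner product of Taylor coefficients.\<close>

definition tcoeff :: "(complex \<Rightarrow> complex) \<Rightarrow> nat \<Rightarrow> complex" where
  "tcoeff f n = (deriv ^^ n) f 0 / of_nat (fact n)"

definition H2 :: "(complex \<Rightarrow> complex) set" where
  "H2 = {f. f holomorphic_on ball 0 1 \<and> summable (\<lambda>n. (cmod (tcoeff f n))^2)}"

definition h2_inner :: "(complex \<Rightarrow> complex) \<Rightarrow> (complex \<Rightarrow> complex) \<Rightarrow> complex" where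
  "h2_inner f g = (\<Sum>n. tcoeff f n * cnj (tcoeff g n))"

definition h2_norm :: "(complex \<Rightarrow> complex) \<Rightarrow> real" where
  "h2_norm f = sqrt (\<Sum>n. (cmod (tcoeff f n))^2)"

definition bfactor :: "complex \<Rightarrow> complex \<Rightarrow> complex" where
  "bfactor a z = (if a = 0 then z else (of_real (cmod a) / a) * (a - z) / (1 - cnj a * z))"

definition blaschke_prod :: "(nat \<Rightarrow> complex) \<Rightarrow> complex \<Rightarrow> complex" where
  "blaschke_prod lam z = (\<Prod>n. bfactor (lam n) z)"

text \<open>Interpolating zero sequence: distinct points of the disk satisfying the
Blaschke condition and Carleson's uniform separation condition
  inf_n prod_{k \<noteq> n} |(lam n - lam k)/(1 - conj(lam k) lam n)| > 0
(the infinite product is the decreasing limit of its finite partial products,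
since all factors are \<le> 1).\<close>

definition interpolating_seq :: "(nat \<Rightarrow> complex) \<Rightarrow> bool" where
  "interpolating_seq lam \<longleftrightarrow>
     (\<forall>n. cmod (lam n) < 1) \<and> inj lam \<and> summable (\<lambda>n. 1 - cmod (lam n)) \<and>
     (\<exists>\<delta>>0. \<forall>n N. \<delta> \<le> (\<Prod>k\<in>{..<N} - {n}. cmod ((lam n - lam k) / (1 - cnj (lam k) * lam n))))"

definition model_space :: "(complex \<Rightarrow> complex) \<Rightarrow> (complex \<Rightarrow> complex) set" where
  "model_space I = {f \<in> H2. \<forall>g\<in>H2. h2_inner f (\<lambda>z. I z * g z) = 0}"

definition bounded_on_disk :: "(complex \<Rightarrow> complex) \<Rightarrow> bool" where
  "bounded_on_disk f \<longleftrightarrow> bounded (f ` ball 0 1)"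

text \<open>Fourier coefficient of index n \<ge> 0 of conj(h) f on the circle:
 sum_j f_(n+j) conj(h_j).\<close>

definition conjmult_coeff :: "(complex \<Rightarrow> complex) \<Rightarrow> (complex \<Rightarrow> complex) \<Rightarrow> nat \<Rightarrow> complex" where
  "conjmult_coeff h f n = (\<Sum>j. tcoeff f (n + j) * cnj (tcoeff h j))"

text \<open>tto_graph I h f g: f is a bounded function in K_I and g = P_I(conj(h) f),
i.e. g \<in> K_I and conj(h) f - g is orthogonal (in L^2) to K_I.\<close>

definition tto_graph :: "(complex \<Rightarrow> complex) \<Rightarrow> (complex \<Rightarrow> complex) \<Rightarrow>
    (complex \<Rightarrow> complex) \<Rightarrow> (complex \<Rightarrow> complex) \<Rightarrow> bool" where
  "tto_graph I h f g \<longleftrightarrow>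
     f \<in> model_space I \<and> bounded_on_disk f \<and> g \<in> model_space I \<and>
     (\<forall>k\<in>model_space I. h2_inner g k = (\<Sum>n. conjmult_coeff h f n * cnj (tcoeff k n)))"

definition tto_bounded :: "(complex \<Rightarrow> complex) \<Rightarrow> (complex \<Rightarrow> complex) \<Rightarrow> bool" where
  "tto_bounded I h \<longleftrightarrow> (\<exists>C. \<forall>f g. tto_graph I h f g \<longrightarrow> h2_norm g \<le> C * h2_norm f)"

text \<open>Range of the bounded extension of A_{conj h} to K_I.\<close>

definition tto_range :: "(complex \<Rightarrow> complex) \<Rightarrow> (complex \<Rightarrow> complex) \<Rightarrow> (complex \<Rightarrow> complex) set" where
  "tto_range I h = {g \<in> H2. \<exists>f fs gs. f \<in> model_space I \<and>
      (\<forall>m. tto_graph I h (fs m) (gs m)) \<and>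
      (\<lambda>m. h2_norm (\<lambda>z. fs m z - f z)) \<longlonglongrightarrow> 0 \<and>
      (\<lambda>m. h2_norm (\<lambda>z. gs m z - g z)) \<longlonglongrightarrow> 0}"

definition stolz :: "complex \<Rightarrow> real \<Rightarrow> complex set" where
  "stolz \<zeta> \<alpha> = {z. cmod z < 1 \<and> cmod (z - \<zeta>) < \<alpha> * (1 - cmod z)}"

definition has_nt_limit :: "(complex \<Rightarrow> complex) \<Rightarrow> complex \<Rightarrow> bool" where
  "has_nt_limit f \<zeta> \<longleftrightarrow> (\<exists>L. \<forall>\<alpha>>1. (f \<longlongrightarrow> L) (at \<zeta> within stolz \<zeta> \<alpha>))"

end

theory Submission
  imports Defs
begin

text \<open>Let \<open>x\<^sub>n\<close> be the normalized reproducing kernel at \<open>\<lambda>\<^sub>n\<close>. By P. Jones' interpolation formula every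
  choice of signs on the \<open>\<lambda>\<^sub>n\<close> is interpolated by a function of uniformly bounded modulus. The adjoint
  of multiplication by it changes the signs of the coefficients of a kernel combination, so
  averaging over signs (the parallelogram law) makes \<open>(x\<^sub>n)\<close> a Riesz sequence. It spans \<open>K\<^sub>I\<close>, since a
  function of \<open>K\<^sub>I\<close> vanishing at all \<open>\<lambda>\<^sub>n\<close> is divisible by \<open>I\<close>, and the operator is diagonal on it:
  \<open>x\<^sub>n\<close> is mapped to the conjugate of \<open>h(\<lambda>\<^sub>n)\<close> times \<open>x\<^sub>n\<close>.

  If the series converges, the Cauchy-Schwarz inequality bounds evaluation of the image on a Stolz angle by the
  norm of the preimage, so limits at \<open>\<zeta>\<close> pass from finite combinations to the whole range.
  Conversely, choosing the arguments of the coefficients \<open>a\<^sub>n\<close> so that the real (or the imaginary)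
  parts of all terms along the radius are nonnegative, boundedness along the radius gives
  \<open>\<Sum>\<bar>a\<^sub>n\<bar> (1 - \<bar>\<lambda>\<^sub>n\<bar>\<^sup>2)\<^sup>1\<^sup>/\<^sup>2 \<bar>h(\<lambda>\<^sub>n)\<bar> / \<bar>\<zeta> - \<lambda>\<^sub>n\<bar> < \<infinity>\<close> for every square-summable \<open>a\<close>, and Landau's theorem
  yields the square summability of the weights.\<close>

section \<open>The Hilbert space of square-summable sequences\<close>

text \<open>All estimates are made on Taylor coefficients, never on boundary values. Members of
  \<open>H2\<close> are arbitrary outside the disk, so a separate type \<open>l2\<close> carries
  norm and completeness.

  The obstacle is the definition of the range: \<open>tto_range\<close> closes the graph over
  arbitrary bounded approximants, while the diagonal action is visible only on kernel combinations,
  and for a general preimage f the product conj(h) f need not be square integrable. The bridge is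
  that the value of the image at each zero is a norm-continuous functional of the preimage
  (\<open>sample\<close>), and values at the zeros determine a member of the model space. Hence any
  two approximating sequences of the same preimage have the same image limit.

  Interpolation at finitely many nodes is enough, because the Riesz inequalities concern finite
  sums; what matters is a bound depending on the separation constant alone. In the converse both
  real and imaginary parts are needed, since neither alone controls the modulus of 1 / (1 -
  w).\<close>

typedef l2 = "{u :: nat \<Rightarrow> complex. summable (\<lambda>n. (cmod (u n))\<^sup>2)}" morphisms seq Abs_l2
  by (rule exI[of _ "\<lambda>_. 0"]) simp

lemma summable_seq: "summable (\<lambda>n. (cmod (seq u n))\<^sup>2)"
  using seq[of u] by simp

lemma seq_Abs_l2: "summable (\<lambda>n. (cmod (u n))\<^sup>2) \<Longrightarrow> seq (Abs_l2 u) = u"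
  by (simp add: Abs_l2_inverse)

lemma l2_eqI: "(\<And>n. seq u n = seq v n) \<Longrightarrow> u = v"
  by (simp add: seq_inject[symmetric] fun_eq_iff)

lemma summable_norm_mult_of_squares:
  fixes u v :: "nat \<Rightarrow> complex"
  assumes "summable (\<lambda>n. (cmod (u n))\<^sup>2)" "summable (\<lambda>n. (cmod (v n))\<^sup>2)"
  shows "summable (\<lambda>n. cmod (u n) * cmod (v n))"
proof (rule summable_comparison_test'[where N = 0])
  show "summable (\<lambda>n. (cmod (u n))\<^sup>2 + (cmod (v n))\<^sup>2)"
    using assms by (rule summable_add)
  show "norm (cmod (u n) * cmod (v n)) \<le> (cmod (u n))\<^sup>2 + (cmod (v n))\<^sup>2" for n
    using sum_squares_bound[of "cmod (u n)" "cmod (v n)"] mult_nonneg_nonneg[of "cmod (u n)" "cmod (v n)"]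
    by (simp add: abs_mult del: mult_nonneg_nonneg)
qed

lemma summable_square_add:
  fixes u v :: "nat \<Rightarrow> complex"
  assumes "summable (\<lambda>n. (cmod (u n))\<^sup>2)" "summable (\<lambda>n. (cmod (v n))\<^sup>2)"
  shows "summable (\<lambda>n. (cmod (u n + v n))\<^sup>2)"
proof (rule summable_comparison_test'[where N = 0])
  show "summable (\<lambda>n. 2 * ((cmod (u n))\<^sup>2 + (cmod (v n))\<^sup>2))"
    by (intro summable_mult summable_add assms)
  fix n
  have "(cmod (u n + v n))\<^sup>2 \<le> (cmod (u n) + cmod (v n))\<^sup>2"
    by (simp add: norm_triangle_ineq power_mono)
  also have "\<dots> \<le> 2 * ((cmod (u n))\<^sup>2 + (cmod (v n))\<^sup>2)"
    using sum_squares_bound[of "cmod (u n)" "cmod (v n)"] by (simp add: power2_sum)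
  finally show "norm ((cmod (u n + v n))\<^sup>2) \<le> 2 * ((cmod (u n))\<^sup>2 + (cmod (v n))\<^sup>2)"
    by simp
qed

lemma summable_square_cmult:
  fixes u :: "nat \<Rightarrow> complex"
  assumes "summable (\<lambda>n. (cmod (u n))\<^sup>2)"
  shows "summable (\<lambda>n. (cmod (c * u n))\<^sup>2)"
  using summable_mult[OF assms, of "(cmod c)\<^sup>2"] by (simp add: norm_mult power_mult_distrib)

text \<open>The class structure put on \<open>l2\<close> is only real, so complex scalars act
  through this map, and \<open>cinner\<close> stands beside the real \<open>inner\<close>, which is
  its real part.\<close>

definition cscale :: "complex \<Rightarrow> l2 \<Rightarrow> l2" where
  "cscale c u = Abs_l2 (\<lambda>n. c * seq u n)"

lemma seq_cscale [simp]: "seq (cscale c u) n = c * seq u n"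
  by (simp add: cscale_def seq_Abs_l2 summable_square_cmult summable_seq)

instantiation l2 :: real_vector
begin

definition zero_l2 :: l2 where "0 = Abs_l2 (\<lambda>_. 0)"
definition plus_l2 :: "l2 \<Rightarrow> l2 \<Rightarrow> l2" where "u + v = Abs_l2 (\<lambda>n. seq u n + seq v n)"
definition uminus_l2 :: "l2 \<Rightarrow> l2" where "- u = cscale (- 1) u"
definition minus_l2 :: "l2 \<Rightarrow> l2 \<Rightarrow> l2" where "u - v = u + - (v :: l2)"
definition scaleR_l2 :: "real \<Rightarrow> l2 \<Rightarrow> l2" where "r *\<^sub>R u = cscale (of_real r) u"

lemma seq_zero [simp]: "seq 0 n = 0"
  by (simp add: zero_l2_def seq_Abs_l2)

lemma seq_add [simp]: "seq (u + v) n = seq u n + seq v n"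
  by (simp add: plus_l2_def seq_Abs_l2 summable_square_add summable_seq)

lemma seq_uminus [simp]: "seq (- u) n = - seq u n"
  by (simp add: uminus_l2_def)

lemma seq_diff [simp]: "seq (u - v) n = seq u n - seq v n"
  by (simp add: minus_l2_def)

lemma seq_scaleR [simp]: "seq (r *\<^sub>R u) n = of_real r * seq u n"
  by (simp add: scaleR_l2_def)

instance
  by standard (auto intro!: l2_eqI simp: algebra_simps)

end

lemma seq_sum [simp]: "seq (\<Sum>i\<in>A. f i) n = (\<Sum>i\<in>A. seq (f i) n)"
  by (induction A rule: infinite_finite_induct) auto

definition cinner :: "l2 \<Rightarrow> l2 \<Rightarrow> complex" where
  "cinner u v = (\<Sum>n. seq u n * cnj (seq v n))"

lemma cinner_sums: "(\<lambda>n. seq u n * cnj (seq v n)) sums cinner u v"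
proof -
  have "summable (\<lambda>n. cmod (seq u n * cnj (seq v n)))"
    using summable_norm_mult_of_squares[OF summable_seq summable_seq] by (simp add: norm_mult)
  then show ?thesis
    unfolding cinner_def by (rule summable_sums[OF summable_norm_cancel])
qed

lemma cinner_eqI: "(\<lambda>n. seq u n * cnj (seq v n)) sums c \<Longrightarrow> cinner u v = c"
  unfolding cinner_def by (rule sums_unique[symmetric])

lemma cinner_add_left: "cinner (u + v) w = cinner u w + cinner v w"
  by (rule cinner_eqI) (use sums_add[OF cinner_sums[of u w] cinner_sums[of v w]] in
    \<open>simp add: distrib_right\<close>)

lemma cinner_cscale_left: "cinner (cscale c u) w = c * cinner u w"
  by (rule cinner_eqI) (use sums_mult[OF cinner_sums[of u w], of c] in \<open>simp add: mult.assoc\<close>)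

lemma cinner_commute: "cinner u v = cnj (cinner v u)"
proof (rule cinner_eqI)
  have "(\<lambda>n. cnj (seq v n * cnj (seq u n))) sums cnj (cinner v u)"
    unfolding sums_cnj by (rule cinner_sums)
  then show "(\<lambda>n. seq u n * cnj (seq v n)) sums cnj (cinner v u)"
    by (simp add: mult.commute)
qed

lemma cinner_cscale_right: "cinner w (cscale c u) = cnj c * cinner w u"
  using cinner_commute[of w u] cinner_commute[of w "cscale c u"] by (simp add: cinner_cscale_left)

lemma cinner_self_sums: "(\<lambda>n. (cmod (seq u n))\<^sup>2) sums Re (cinner u u)"
proof -
  have "Re (seq u n * cnj (seq u n)) = (cmod (seq u n))\<^sup>2" for n
    unfolding cmod_power2 by (simp add: power2_eq_square)
  then show ?thesis using sums_Re[OF cinner_sums[of u u]] by simp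
qed

instantiation l2 :: real_inner
begin

definition inner_l2 :: "l2 \<Rightarrow> l2 \<Rightarrow> real" where "inner u v = Re (cinner u v)"
definition norm_l2 :: "l2 \<Rightarrow> real" where "norm u = sqrt (inner u (u :: l2))"
definition dist_l2 :: "l2 \<Rightarrow> l2 \<Rightarrow> real" where "dist u v = norm (u - v :: l2)"
definition sgn_l2 :: "l2 \<Rightarrow> l2" where "sgn u = inverse (norm u) *\<^sub>R (u :: l2)"
definition uniformity_l2 :: "(l2 \<times> l2) filter" where
  "uniformity_l2 = (INF e\<in>{0 <..}. principal {(x, y). dist x y < e})"
definition open_l2 :: "l2 set \<Rightarrow> bool" where
  "open_l2 U \<longleftrightarrow> (\<forall>x\<in>U. \<forall>\<^sub>F (x', y) in uniformity. x' = x \<longrightarrow> y \<in> U)"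

instance
proof
  fix r :: real and x y z :: l2
  show "dist x y = norm (x - y)" by (simp add: dist_l2_def)
  show "sgn x = inverse (norm x) *\<^sub>R x" by (simp add: sgn_l2_def)
  show "inner x y = inner y x"
    unfolding inner_l2_def by (subst cinner_commute) simp
  show "inner (x + y) z = inner x z + inner y z"
    by (simp add: inner_l2_def cinner_add_left)
  show "inner (r *\<^sub>R x) y = r * inner x y"
    by (simp add: inner_l2_def scaleR_l2_def cinner_cscale_left)
  show "0 \<le> inner x x"
    unfolding inner_l2_def using sums_le[OF _ sums_zero cinner_self_sums[of x]] by simp
  show "(inner x x = 0) = (x = 0)"
  proof
    assume "inner x x = 0"
    then have "(\<Sum>n. (cmod (seq x n))\<^sup>2) = 0"
      using cinner_self_sums[of x] by (simp add: inner_l2_def sums_iff)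
    then have "\<forall>n. (cmod (seq x n))\<^sup>2 = 0"
      using suminf_eq_zero_iff[OF summable_seq[of x]] by simp
    then show "x = 0" by (auto intro: l2_eqI)
  next
    assume "x = 0"
    then show "inner x x = 0" by (simp add: inner_l2_def cinner_def)
  qed
  show "norm x = sqrt (inner x x)" by (simp add: norm_l2_def)
  show "uniformity = (INF e\<in>{0 <..}. principal {(x :: l2, y). dist x y < e})"
    by (rule uniformity_l2_def)
  show "open U \<longleftrightarrow> (\<forall>x\<in>U. \<forall>\<^sub>F (x', y) in uniformity. x' = x \<longrightarrow> y \<in> U)" for U :: "l2 set"
    by (rule open_l2_def)
qed

end

lemma norm_l2_sums: "(\<lambda>n. (cmod (seq u n))\<^sup>2) sums (norm u)\<^sup>2"
  using cinner_self_sums[of u] by (simp add: power2_norm_eq_inner inner_l2_def)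

lemma norm_l2_eq: "norm u = sqrt (\<Sum>n. (cmod (seq u n))\<^sup>2)"
  using norm_l2_sums[of u] by (simp add: sums_iff)

lemma sum_le_norm_l2: "(\<Sum>n<N. (cmod (seq u n))\<^sup>2) \<le> (norm u)\<^sup>2"
  using sum_le_suminf[OF summable_seq[of u], of "{..<N}"] norm_l2_sums[of u]
  by (simp add: sums_iff)

lemma norm_l2_le:
  assumes "\<And>N. (\<Sum>n<N. (cmod (seq u n))\<^sup>2) \<le> C\<^sup>2" "0 \<le> C"
  shows "norm u \<le> C"
proof -
  have "(norm u)\<^sup>2 \<le> C\<^sup>2"
    using LIMSEQ_le_const2[OF norm_l2_sums[of u, unfolded sums_def]] assms(1) by blast
  then show ?thesis using assms(2) by (rule power2_le_imp_le)
qed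

lemma cmod_seq_le_norm: "cmod (seq u n) \<le> norm u"
proof -
  have "(cmod (seq u n))\<^sup>2 \<le> (\<Sum>k<Suc n. (cmod (seq u k))\<^sup>2)"
    by (simp add: sum_nonneg)
  also have "\<dots> \<le> (norm u)\<^sup>2" by (rule sum_le_norm_l2)
  finally show ?thesis by (rule power2_le_imp_le) simp
qed

lemma Re_cinner: "Re (cinner u v) = inner u v"
  by (simp add: inner_l2_def)

lemma norm_cscale [simp]: "norm (cscale c u) = cmod c * norm u"
proof -
  have "(norm (cscale c u))\<^sup>2 = (cmod c * norm u)\<^sup>2"
    using sums_mult[OF norm_l2_sums[of u], of "(cmod c)\<^sup>2"]
    by (intro sums_unique2[OF norm_l2_sums[of "cscale c u"]]) (simp add: norm_mult power_mult_distrib)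
  then show ?thesis
    by (rule power2_eq_imp_eq) auto
qed

lemma cmod_cinner_le: "cmod (cinner u v) \<le> norm u * norm v"
proof (cases "cinner u v = 0")
  case False
  \<comment> \<open>Rotating \<open>v\<close> by the phase of \<open>cinner u v\<close> makes the
    product real and nonnegative, so the real Cauchy-Schwarz inequality applies.\<close>
  define c where "c = cinner u v / of_real (cmod (cinner u v))"
  have c: "cmod c = 1" using False by (simp add: c_def norm_divide)
  have "cinner u (cscale c v) = cinner u v * cnj (cinner u v) / of_real (cmod (cinner u v))"
    by (simp add: cinner_cscale_right c_def)
  also have "\<dots> = of_real ((cmod (cinner u v))\<^sup>2) / of_real (cmod (cinner u v))"
    by (simp only: complex_norm_square)
  also have "\<dots> = of_real (cmod (cinner u v))"
    using False by (simp add: power2_eq_square)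
  finally have "cinner u (cscale c v) = of_real (cmod (cinner u v))" .
  then have "cmod (cinner u v) = inner u (cscale c v)"
    by (simp flip: Re_cinner)
  also have "\<dots> \<le> norm u * norm (cscale c v)" by (rule norm_cauchy_schwarz)
  finally show ?thesis using c by simp
qed simp

text \<open>Coordinatewise limits exist, and the Cauchy estimate is carried to them on finite
  partial sums of squares, so no limit is interchanged with a series.\<close>

instance l2 :: complete_space
proof
  fix X :: "nat \<Rightarrow> l2"
  assume "Cauchy X"
  then have Cau: "\<And>e. e > 0 \<Longrightarrow> \<exists>M. \<forall>m\<ge>M. \<forall>n\<ge>M. norm (X m - X n) < e"
    by (simp add: Cauchy_def dist_norm)
  have Cauk: "Cauchy (\<lambda>m. seq (X m) k)" for k
    unfolding Cauchy_def dist_norm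
  proof (intro allI impI)
    fix e :: real assume "e > 0"
    then obtain M where M: "\<forall>m\<ge>M. \<forall>n\<ge>M. norm (X m - X n) < e" using Cau[of e] by blast
    have "cmod (seq (X m) k - seq (X n) k) < e" if "m \<ge> M" "n \<ge> M" for m n
      using cmod_seq_le_norm[of "X m - X n" k] M that by (simp add: le_less_trans)
    then show "\<exists>M. \<forall>m\<ge>M. \<forall>n\<ge>M. cmod (seq (X m) k - seq (X n) k) < e" by blast
  qed
  then have "\<exists>l. (\<lambda>m. seq (X m) k) \<longlonglongrightarrow> l" for k
    using Cauchy_convergent[OF Cauk[of k]] by (simp add: convergent_def)
  then have "\<exists>l. \<forall>k. (\<lambda>m. seq (X m) k) \<longlonglongrightarrow> l k" by (intro choice allI)
  then obtain l where l: "\<And>k. (\<lambda>m. seq (X m) k) \<longlonglongrightarrow> l k" by blast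
  have close: "(\<Sum>k<N. (cmod (seq (X m) k - l k))\<^sup>2) \<le> e\<^sup>2"
    if M: "\<forall>m\<ge>M. \<forall>n\<ge>M. norm (X m - X n) < e" and m: "m \<ge> M" for M e m N
  proof (rule LIMSEQ_le_const2)
    show "(\<lambda>n. \<Sum>k<N. (cmod (seq (X m) k - seq (X n) k))\<^sup>2) \<longlonglongrightarrow> (\<Sum>k<N. (cmod (seq (X m) k - l k))\<^sup>2)"
      by (intro tendsto_intros l)
    show "\<exists>n0. \<forall>n\<ge>n0. (\<Sum>k<N. (cmod (seq (X m) k - seq (X n) k))\<^sup>2) \<le> e\<^sup>2"
    proof (intro exI allI impI)
      fix n assume "n \<ge> M"
      then have "norm (X m - X n) \<le> e" using M m by (simp add: less_imp_le)
      then have "(norm (X m - X n))\<^sup>2 \<le> e\<^sup>2" by (simp add: power_mono)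
      then show "(\<Sum>k<N. (cmod (seq (X m) k - seq (X n) k))\<^sup>2) \<le> e\<^sup>2"
        using sum_le_norm_l2[of "X m - X n" N] by simp
    qed
  qed
  obtain M1 where M1: "\<forall>m\<ge>M1. \<forall>n\<ge>M1. norm (X m - X n) < 1" using Cau[of 1] by auto
  have "summable (\<lambda>k. (cmod (seq (X M1) k - l k))\<^sup>2)"
    by (rule summableI_nonneg_bounded) (use close[OF M1, of M1] in auto)
  from summable_square_add[OF summable_seq[of "- X M1"] this]
  have lsum: "summable (\<lambda>k. (cmod (l k))\<^sup>2)"
    by (simp add: norm_minus_commute)
  have "X \<longlonglongrightarrow> Abs_l2 l"
  proof (rule LIMSEQ_I)
    fix r :: real assume "r > 0"
    then obtain M where M: "\<forall>m\<ge>M. \<forall>n\<ge>M. norm (X m - X n) < r / 2" using Cau[of "r / 2"] by auto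
    have "norm (X m - Abs_l2 l) < r" if "m \<ge> M" for m
    proof -
      have "norm (X m - Abs_l2 l) \<le> r / 2"
        using close[OF M that] \<open>r > 0\<close> by (intro norm_l2_le) (auto simp: seq_Abs_l2[OF lsum])
      then show ?thesis using \<open>r > 0\<close> by simp
    qed
    then show "\<exists>M. \<forall>m\<ge>M. norm (X m - Abs_l2 l) < r" by blast
  qed
  then show "convergent X" by (auto simp: convergent_def)
qed

instance l2 :: banach ..

section \<open>The Hardy space as a space of coefficient sequences\<close>

lemma tcoeff_eqI:
  assumes "\<And>z. cmod z < 1 \<Longrightarrow> (\<lambda>n. a n * z ^ n) sums f z"
  shows "tcoeff f n = a n"
proof -
  have "conv_radius a \<ge> 1"
  proof (rule conv_radius_geI_ex')
    fix r :: real assume "0 < r" "ereal r < 1"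
    then show "summable (\<lambda>n. a n * of_real r ^ n)"
      using assms[of "of_real r"] by (simp add: sums_iff)
  qed
  then have "fps_conv_radius (Abs_fps a) > 0"
    by (simp add: fps_conv_radius_def less_le_trans[of 0 1])
  moreover have "eventually (\<lambda>z. eval_fps (Abs_fps a) z = f z) (nhds 0)"
  proof -
    have "eventually (\<lambda>z::complex. z \<in> ball 0 1) (nhds 0)"
      by (rule eventually_nhds_in_open) auto
    then show ?thesis
      by eventually_elim (use assms in \<open>simp add: eval_fps_def sums_iff\<close>)
  qed
  ultimately have "f has_fps_expansion Abs_fps a"
    by (simp add: has_fps_expansion_def)
  from fps_nth_fps_expansion[OF this, of n] show ?thesis
    by (simp add: tcoeff_def)
qed

lemma tcoeff_sums:
  assumes "f holomorphic_on ball 0 1" "cmod z < 1"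
  shows "(\<lambda>n. tcoeff f n * z ^ n) sums f z"
  using holomorphic_power_series[OF assms(1), of z] assms(2) by (simp add: tcoeff_def)

lemma holomorphic_of_sums:
  assumes "\<And>z. cmod z < 1 \<Longrightarrow> (\<lambda>n. a n * z ^ n) sums f z"
  shows "f holomorphic_on ball 0 1"
  by (rule power_series_holomorphic[where a = a]) (use assms in simp)

definition ev :: "l2 \<Rightarrow> complex \<Rightarrow> complex" where
  "ev u z = (\<Sum>n. seq u n * z ^ n)"

text \<open>The Szego kernel 1 / (1 - conj(a) z), given by its coefficients. For \<open>a\<close>
  outside the disk the sequence is not square summable, hence the hypothesis
  \<open>cmod a < 1\<close> wherever \<open>ker\<close> is used.\<close>

definition ker :: "complex \<Rightarrow> l2" where
  "ker a = Abs_l2 (\<lambda>n. cnj a ^ n)"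

lemma geometric_cmod_sums:
  assumes "cmod a < 1"
  shows "(\<lambda>n. (cmod (cnj a ^ n))\<^sup>2) sums (1 / (1 - (cmod a)\<^sup>2))"
proof -
  have "(\<lambda>n. ((cmod a)\<^sup>2) ^ n) sums (1 / (1 - (cmod a)\<^sup>2))"
    using assms by (intro geometric_sums) (simp add: power_less_one_iff abs_square_less_1)
  moreover have "(cmod (cnj a ^ n))\<^sup>2 = ((cmod a)\<^sup>2) ^ n" for n
    by (simp add: norm_power flip: power_mult) (simp add: mult.commute)
  ultimately show ?thesis by simp
qed

lemma seq_ker: "cmod a < 1 \<Longrightarrow> seq (ker a) n = cnj a ^ n"
  unfolding ker_def by (simp only: seq_Abs_l2[OF sums_summable[OF geometric_cmod_sums]])

lemma norm_ker: "cmod a < 1 \<Longrightarrow> (norm (ker a))\<^sup>2 = 1 / (1 - (cmod a)\<^sup>2)"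
  using norm_l2_sums[of "ker a"] geometric_cmod_sums[of a]
  by (simp only: seq_ker sums_unique2)

lemma cinner_ker: "cmod z < 1 \<Longrightarrow> cinner u (ker z) = ev u z"
  by (simp add: cinner_def ev_def seq_ker)

lemma ev_sums: "cmod z < 1 \<Longrightarrow> (\<lambda>n. seq u n * z ^ n) sums ev u z"
  using cinner_sums[of u "ker z"] by (simp add: cinner_ker seq_ker)

lemma cmod_ev_le: "cmod z < 1 \<Longrightarrow> cmod (ev u z) \<le> norm u * norm (ker z)"
  using cmod_cinner_le[of u "ker z"] by (simp add: cinner_ker)

lemma ev_add: "cmod z < 1 \<Longrightarrow> ev (u + v) z = ev u z + ev v z"
  by (simp add: cinner_add_left flip: cinner_ker)

lemma ev_cscale: "cmod z < 1 \<Longrightarrow> ev (cscale c u) z = c * ev u z"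
  by (simp add: cinner_cscale_left flip: cinner_ker)

lemma ev_diff: "cmod z < 1 \<Longrightarrow> ev (u - v) z = ev u z - ev v z"
  by (metis ev_add add_diff_cancel_right' diff_add_cancel)

lemma ev_zero [simp]: "ev 0 z = 0"
  by (simp add: ev_def)

lemma ev_sum: "cmod z < 1 \<Longrightarrow> ev (\<Sum>i\<in>A. f i) z = (\<Sum>i\<in>A. ev (f i) z)"
  by (induction A rule: infinite_finite_induct) (auto simp: ev_add)

lemma ev_ker:
  assumes "cmod a < 1" "cmod z \<le> 1"
  shows "ev (ker a) z = 1 / (1 - cnj a * z)"
proof -
  have "cmod (cnj a * z) < 1"
    using assms mult_left_le[of "cmod z" "cmod a"] by (simp add: norm_mult)
  from geometric_sums[OF this] show ?thesis
    using assms by (simp add: ev_def seq_ker power_mult_distrib sums_iff)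
qed

definition taylor :: "(complex \<Rightarrow> complex) \<Rightarrow> l2" where
  "taylor f = Abs_l2 (tcoeff f)"

lemma seq_taylor: "f \<in> H2 \<Longrightarrow> seq (taylor f) = tcoeff f"
  by (simp add: taylor_def H2_def seq_Abs_l2)

lemma ev_taylor: "f \<in> H2 \<Longrightarrow> cmod z < 1 \<Longrightarrow> ev (taylor f) z = f z"
  using tcoeff_sums[of f z] by (simp add: ev_def seq_taylor H2_def sums_iff)

lemma holomorphic_H2: "f \<in> H2 \<Longrightarrow> f holomorphic_on ball 0 1"
  by (simp add: H2_def)

text \<open>Only values in the disk are compared, since they determine all Taylor coefficients at
  0.\<close>

lemma H2_eqI:
  assumes "\<And>z. cmod z < 1 \<Longrightarrow> f z = ev u z"
  shows "f \<in> H2" "taylor f = u"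
proof -
  have *: "(\<lambda>n. seq u n * z ^ n) sums f z" if "cmod z < 1" for z
    using ev_sums[OF that, of u] assms[OF that] by simp
  have "tcoeff f = seq u" using tcoeff_eqI[of "seq u" f, OF *] by blast
  then show "f \<in> H2" "taylor f = u"
    using holomorphic_of_sums[of "seq u" f, OF *] summable_seq[of u]
    by (simp_all add: H2_def taylor_def seq_inverse)
qed

lemma ev_in_H2: "ev u \<in> H2" and taylor_ev [simp]: "taylor (ev u) = u"
  by (rule H2_eqI; simp)+

lemma holomorphic_ev: "ev u holomorphic_on ball 0 1"
  by (rule holomorphic_H2[OF ev_in_H2])

lemma H2_diff:
  assumes "f \<in> H2" "g \<in> H2"
  shows "(\<lambda>z. f z - g z) \<in> H2" "taylor (\<lambda>z. f z - g z) = taylor f - taylor g"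
  by (rule H2_eqI[of _ "taylor f - taylor g"]; simp add: ev_diff ev_taylor assms)+

lemma h2_norm_eq: "f \<in> H2 \<Longrightarrow> h2_norm f = norm (taylor f)"
  by (simp add: h2_norm_def norm_l2_eq seq_taylor)

lemma h2_inner_eq: "f \<in> H2 \<Longrightarrow> g \<in> H2 \<Longrightarrow> h2_inner f g = cinner (taylor f) (taylor g)"
  by (simp add: h2_inner_def cinner_def seq_taylor)

section \<open>Parseval's identity on circles and domination near the boundary\<close>

text \<open>Orthogonality of the characters of the cyclic group of order \<open>N\<close>; the
  bounds on \<open>n\<close> and \<open>m\<close> exclude distinct exponents that agree modulo
  \<open>N\<close>.\<close>

lemma sum_roots_of_unity:
  fixes N n m :: nat
  assumes "n < N" "m < N"
  defines "w \<equiv> \<lambda>j. cis (2 * pi * real j / real N)"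
  shows "(\<Sum>j<N. w j ^ n * cnj (w j) ^ m) = (if n = m then of_nat N else 0)"
proof -
  define x where "x = cis (2 * pi / real N)"
  define y where "y = x ^ n * cnj x ^ m"
  have w: "w j = x ^ j" for j
    unfolding w_def x_def by (subst Complex.DeMoivre) (simp add: mult_ac)
  have xx: "x * cnj x = 1"
    by (simp add: x_def cis_cnj cis_mult)
  have wy: "w j ^ n * cnj (w j) ^ m = y ^ j" for j
    by (simp add: w y_def power_mult_distrib flip: power_mult) (simp add: mult.commute)
  show ?thesis
  proof (cases "n = m")
    case True
    then have "y = 1" using xx by (simp add: y_def flip: power_mult_distrib)
    then show ?thesis unfolding wy using True by simp
  next
    case False
    have xN: "x ^ N = 1" using assms by (simp add: x_def Complex.DeMoivre)
    have "y ^ N = (x ^ N) ^ n * cnj (x ^ N) ^ m"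
      by (simp add: y_def power_mult_distrib flip: power_mult) (simp add: mult.commute)
    then have yN: "y ^ N = 1" by (simp add: xN)
    have "y \<noteq> 1"
    proof
      assume "y = 1"
      have "y * x ^ m = x ^ n * (x * cnj x) ^ m"
        by (simp only: y_def power_mult_distrib mult_ac)
      then have "x ^ n = x ^ m" using \<open>y = 1\<close> xx by simp
      moreover have "x ^ k = exp (2 * of_real pi * \<i> * of_nat k / of_nat N)" for k
        unfolding x_def Complex.DeMoivre unfolding cis_conv_exp
        by (rule arg_cong[where f = exp]) (simp add: mult_ac)
      ultimately have "exp (2 * of_real pi * \<i> * of_nat n / of_nat N) = exp (2 * of_real pi * \<i> * of_nat m / of_nat N)"
        by simp
      then have "n mod N = m mod N"
        using assms by (subst (asm) complex_root_unity_eq) (auto simp: cong_def)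
      then show False using assms False by simp
    qed
    then show ?thesis
      using False yN by (simp add: wy geometric_sum)
  qed
qed

lemma mean_square_polynomial:
  fixes b :: "nat \<Rightarrow> complex" and N :: nat
  defines "w \<equiv> \<lambda>j. cis (2 * pi * real j / real N)"
  shows "(\<Sum>j<N. (cmod (\<Sum>n<N. b n * w j ^ n))\<^sup>2) = real N * (\<Sum>n<N. (cmod (b n))\<^sup>2)"
proof -
  have "complex_of_real (\<Sum>j<N. (cmod (\<Sum>n<N. b n * w j ^ n))\<^sup>2)
      = (\<Sum>j<N. \<Sum>n<N. \<Sum>m<N. (b n * cnj (b m)) * (w j ^ n * cnj (w j) ^ m))"
    by (simp only: of_real_sum complex_norm_square cnj_sum sum_product complex_cnj_mult
        complex_cnj_power mult_ac)
  also have "\<dots> = (\<Sum>n<N. \<Sum>m<N. (b n * cnj (b m)) * (\<Sum>j<N. w j ^ n * cnj (w j) ^ m))"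
    by (subst sum.swap, rule sum.cong[OF refl], subst sum.swap) (simp add: sum_distrib_left)
  also have "\<dots> = (\<Sum>n<N. \<Sum>m<N. (if n = m then of_nat N * (b n * cnj (b n)) else 0))"
    unfolding w_def by (intro sum.cong refl) (simp add: sum_roots_of_unity del: complex_cnj_power)
  also have "\<dots> = of_real (real N * (\<Sum>n<N. (cmod (b n))\<^sup>2))"
    by (simp add: sum_distrib_left complex_norm_square[symmetric] del: of_real_power)
  finally show ?thesis by (simp only: of_real_eq_iff)
qed

text \<open>Discrete averages over the roots of unity replace the integral means over a circle.\<close>

lemma parseval_circle:
  assumes q: "q holomorphic_on ball 0 1" and r: "0 \<le> r" "r < 1"
  shows "summable (\<lambda>n. (cmod (tcoeff q n) * r ^ n)\<^sup>2)"
    and "(\<lambda>N. (\<Sum>j<N. (cmod (q (of_real r * cis (2 * pi * real j / real N))))\<^sup>2) / real N)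
           \<longlonglongrightarrow> (\<Sum>n. (cmod (tcoeff q n) * r ^ n)\<^sup>2)"
proof -
  define a where "a n = cmod (tcoeff q n) * r ^ n" for n
  have a0: "a n \<ge> 0" for n using r by (simp add: a_def)
  \<comment> \<open>Convergence at the larger radius \<open>(1 + r) / 2\<close> gives absolute
    convergence at radius \<open>r\<close>.\<close>
  have "summable (\<lambda>n. tcoeff q n * of_real ((1 + r) / 2) ^ n)"
    using tcoeff_sums[OF q, of "of_real ((1 + r) / 2)"] r by (simp add: sums_iff flip: of_real_add)
  then have "summable (\<lambda>n. norm (tcoeff q n * of_real r ^ n))"
    by (rule powser_insidea) (use r in \<open>simp flip: of_real_add\<close>)
  then have sa: "summable a"
    using r by (simp add: a_def[abs_def] norm_mult norm_power)
  define S where "S = suminf a"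
  have S0: "S \<ge> 0" unfolding S_def by (rule suminf_nonneg[OF sa a0])
  have aS: "sum a {..<N} \<le> S" for N
    unfolding S_def by (rule sum_le_suminf[OF sa]) (use a0 in auto)
  show sa2: "summable (\<lambda>n. (a n)\<^sup>2)"
  proof (rule summable_comparison_test'[where N = 0])
    show "summable (\<lambda>n. S * a n)" by (rule summable_mult[OF sa])
    fix n
    have "a n \<le> sum a {..<Suc n}" using a0 by (simp add: sum_nonneg)
    then have "a n \<le> S" using aS order_trans by blast
    then show "norm ((a n)\<^sup>2) \<le> S * a n"
      using a0[of n] by (simp add: power2_eq_square mult_right_mono)
  qed
  define e where "e N = S - sum a {..<N}" for N
  have e: "e \<longlonglongrightarrow> 0"
    unfolding e_def S_def using tendsto_diff[OF tendsto_const summable_LIMSEQ[OF sa], of "suminf a"]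
    by simp
  define M where "M N = (\<Sum>j<N. (cmod (q (of_real r * cis (2 * pi * real j / real N))))\<^sup>2) / real N" for N
  \<comment> \<open>For the series truncated after \<open>N\<close> terms the discrete Parseval
    identity is exact. Truncation costs at most \<open>2 * S * e N\<close>: both moduli are at most
    \<open>S\<close> and they differ by at most the tail \<open>e N\<close>.\<close>
  have bound: "\<bar>M N - (\<Sum>n<N. (a n)\<^sup>2)\<bar> \<le> 2 * S * e N" if "N > 0" for N
  proof -
    define w where "w j = cis (2 * pi * real j / real N)" for j
    define p where "p j = (\<Sum>n<N. (tcoeff q n * of_real r ^ n) * w j ^ n)" for j
    have pt: "\<bar>(cmod (q (of_real r * w j)))\<^sup>2 - (cmod (p j))\<^sup>2\<bar> \<le> 2 * S * e N" for j
    proof -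
      have w1: "cmod (w j) = 1" by (simp add: w_def)
      have sm: "(\<lambda>n. tcoeff q n * (of_real r * w j) ^ n) sums q (of_real r * w j)"
        by (rule tcoeff_sums[OF q]) (use r w1 in \<open>simp add: norm_mult\<close>)
      have nt: "cmod (tcoeff q n * (of_real r * w j) ^ n) = a n" for n
        using r w1 by (simp add: norm_mult norm_power a_def)
      have 1: "cmod (q (of_real r * w j)) \<le> S"
        using summable_norm[of "\<lambda>n. tcoeff q n * (of_real r * w j) ^ n"] sm nt sa
        by (simp add: S_def sums_iff)
      have "p j = (\<Sum>n<N. tcoeff q n * (of_real r * w j) ^ n)"
        by (simp add: p_def power_mult_distrib mult_ac)
      then have 2: "q (of_real r * w j) - p j = (\<Sum>n. tcoeff q (n + N) * (of_real r * w j) ^ (n + N))"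
        using suminf_minus_initial_segment[OF sums_summable[OF sm], of N] sm by (simp add: sums_iff)
      have "cmod (p j) \<le> (\<Sum>n<N. a n)"
        unfolding p_def using r w1 by (intro order_trans[OF norm_sum]) (simp add: norm_mult norm_power a_def)
      then have 3: "cmod (p j) \<le> S" using aS[of N] by simp
      have ss: "summable (\<lambda>n. a (n + N))" using sa by (simp add: summable_iff_shift)
      have "cmod (q (of_real r * w j) - p j) \<le> (\<Sum>n. a (n + N))"
        unfolding 2 by (rule order_trans[OF summable_norm]) (use ss nt in auto)
      also have "\<dots> = e N"
        by (simp add: e_def S_def suminf_minus_initial_segment[OF sa])
      finally have 4: "\<bar>cmod (q (of_real r * w j)) - cmod (p j)\<bar> \<le> e N"
        using norm_triangle_ineq3[of "q (of_real r * w j)" "p j"] by linarith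
      have "\<bar>(cmod (q (of_real r * w j)))\<^sup>2 - (cmod (p j))\<^sup>2\<bar>
          = (cmod (q (of_real r * w j)) + cmod (p j)) * \<bar>cmod (q (of_real r * w j)) - cmod (p j)\<bar>"
        by (simp add: power2_eq_square square_diff_square_factored abs_mult)
      also have "\<dots> \<le> (2 * S) * e N"
        using 1 3 4 S0 by (intro mult_mono) auto
      finally show ?thesis .
    qed
    have "(\<Sum>j<N. (cmod (p j))\<^sup>2) = real N * (\<Sum>n<N. (a n)\<^sup>2)"
      unfolding p_def w_def mean_square_polynomial
      using r by (simp add: a_def norm_mult norm_power power_mult_distrib)
    then have "M N - (\<Sum>n<N. (a n)\<^sup>2) = (\<Sum>j<N. (cmod (q (of_real r * w j)))\<^sup>2 - (cmod (p j))\<^sup>2) / real N"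
      using that by (simp add: M_def w_def sum_subtractf field_simps)
    also have "\<bar>\<dots>\<bar> \<le> (\<Sum>j<N. 2 * S * e N) / real N"
      unfolding abs_divide by (simp only: abs_of_nat)
        (intro divide_right_mono order_trans[OF sum_abs] sum_mono pt of_nat_0_le_iff)
    finally show ?thesis using that by simp
  qed
  have "(\<lambda>N. M N - (\<Sum>n<N. (a n)\<^sup>2)) \<longlonglongrightarrow> 0"
  proof (rule Lim_null_comparison)
    show "\<forall>\<^sub>F N in sequentially. norm (M N - (\<Sum>n<N. (a n)\<^sup>2)) \<le> 2 * S * e N"
      using eventually_gt_at_top[of 0] by eventually_elim (use bound in simp)
    show "(\<lambda>N. 2 * S * e N) \<longlonglongrightarrow> 0"
      using tendsto_mult[OF tendsto_const e, of "2 * S"] by simp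
  qed
  from tendsto_add[OF this summable_LIMSEQ[OF sa2]]
  show "M \<longlonglongrightarrow> (\<Sum>n. (a n)\<^sup>2)" by simp
qed

text \<open>Square means over circles of radius close to 1 determine the norm, so domination is
  required only near the boundary. This allows division by a Blaschke factor, whose modulus is close
  to 1 there.\<close>

lemma H2_dominated:
  assumes q: "q holomorphic_on ball 0 1" and f: "f \<in> H2" and R: "R < 1" and C: "0 \<le> C"
    and le: "\<And>z. R < cmod z \<Longrightarrow> cmod z < 1 \<Longrightarrow> cmod (q z) \<le> C * cmod (f z)"
  shows "q \<in> H2" "norm (taylor q) \<le> C * norm (taylor f)"
proof -
  define K where "K = C * norm (taylor f)"
  have part: "(\<Sum>n<N. (cmod (tcoeff q n) * r ^ n)\<^sup>2) \<le> K\<^sup>2"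
    if r: "max R 0 < r" "r < 1" for r N
  proof -
    have r0: "0 \<le> r" using r by simp
    have "(\<Sum>n. (cmod (tcoeff q n) * r ^ n)\<^sup>2) \<le> C\<^sup>2 * (\<Sum>n. (cmod (tcoeff f n) * r ^ n)\<^sup>2)"
    proof (rule LIMSEQ_le[OF parseval_circle(2)[OF q r0 r(2)]
          tendsto_mult[OF tendsto_const parseval_circle(2)[OF holomorphic_H2[OF f] r0 r(2)]]], intro exI allI impI)
      fix N :: nat
      have "cmod (q (of_real r * cis (2 * pi * real j / real N)))
          \<le> C * cmod (f (of_real r * cis (2 * pi * real j / real N)))" for j
        by (rule le) (use r in \<open>auto simp: norm_mult\<close>)
      then have "(cmod (q (of_real r * cis (2 * pi * real j / real N))))\<^sup>2
          \<le> C\<^sup>2 * (cmod (f (of_real r * cis (2 * pi * real j / real N))))\<^sup>2" for j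
        using power_mono[of _ _ 2] by (metis norm_ge_zero power_mult_distrib)
      then show "(\<Sum>j<N. (cmod (q (of_real r * cis (2 * pi * real j / real N))))\<^sup>2) / real N
          \<le> C\<^sup>2 * ((\<Sum>j<N. (cmod (f (of_real r * cis (2 * pi * real j / real N))))\<^sup>2) / real N)"
        by (simp add: sum_distrib_left divide_right_mono sum_mono)
    qed
    also have "(\<Sum>n. (cmod (tcoeff f n) * r ^ n)\<^sup>2) \<le> (norm (taylor f))\<^sup>2"
    proof (rule suminf_le_const[OF parseval_circle(1)[OF holomorphic_H2[OF f] r0 r(2)]])
      fix N
      have "(cmod (tcoeff f n) * r ^ n)\<^sup>2 \<le> (cmod (seq (taylor f) n))\<^sup>2" for n
        using r r0 by (intro power_mono) (simp_all add: seq_taylor[OF f] mult_left_le power_le_one)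
      then have "(\<Sum>n<N. (cmod (tcoeff f n) * r ^ n)\<^sup>2) \<le> (\<Sum>n<N. (cmod (seq (taylor f) n))\<^sup>2)"
        by (intro sum_mono)
      then show "(\<Sum>n<N. (cmod (tcoeff f n) * r ^ n)\<^sup>2) \<le> (norm (taylor f))\<^sup>2"
        using sum_le_norm_l2[of "taylor f" N] by linarith
    qed
    finally have "(\<Sum>n. (cmod (tcoeff q n) * r ^ n)\<^sup>2) \<le> K\<^sup>2"
      by (simp add: K_def power_mult_distrib mult_left_mono)
    moreover have "(\<Sum>n<N. (cmod (tcoeff q n) * r ^ n)\<^sup>2) \<le> (\<Sum>n. (cmod (tcoeff q n) * r ^ n)\<^sup>2)"
      by (rule sum_le_suminf[OF parseval_circle(1)[OF q r0 r(2)]]) auto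
    ultimately show ?thesis by linarith
  qed
  \<comment> \<open>Each finite partial sum is continuous in \<open>r\<close>, so the uniform bound
    \<open>part\<close> reaches \<open>r = 1\<close> before summability is known.\<close>
  have fin: "(\<Sum>n<N. (cmod (tcoeff q n))\<^sup>2) \<le> K\<^sup>2" for N
  proof (rule tendsto_upperbound)
    show "((\<lambda>r. \<Sum>n<N. (cmod (tcoeff q n) * r ^ n)\<^sup>2) \<longlongrightarrow> (\<Sum>n<N. (cmod (tcoeff q n))\<^sup>2)) (at_left 1)"
      by (rule tendsto_eq_intros refl | simp)+
    have "\<forall>\<^sub>F r in at_left (1::real). r \<in> {max R 0 <..< 1}"
      by (rule eventually_at_left_real) (use R in auto)
    then show "\<forall>\<^sub>F r in at_left 1. (\<Sum>n<N. (cmod (tcoeff q n) * r ^ n)\<^sup>2) \<le> K\<^sup>2"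
      by eventually_elim (use part in auto)
  qed auto
  have "summable (\<lambda>n. (cmod (tcoeff q n))\<^sup>2)"
    by (rule summableI_nonneg_bounded[OF _ fin]) auto
  then show qH: "q \<in> H2" using q by (simp add: H2_def)
  show "norm (taylor q) \<le> C * norm (taylor f)"
    unfolding K_def[symmetric]
    by (rule norm_l2_le) (use fin C in \<open>auto simp: seq_taylor[OF qH] K_def\<close>)
qed

section \<open>Finite interpolation with a uniform bound\<close>

text \<open>A Blaschke factor without the unimodular normalization of \<open>bfactor\<close>, hence
  without a case distinction at \<open>a = 0\<close>.\<close>

definition mob :: "complex \<Rightarrow> complex \<Rightarrow> complex" where
  "mob a z = (a - z) / (1 - cnj a * z)"

lemma one_minus_cmod_le:
  assumes "cmod a \<le> 1" "cmod z \<le> 1"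
  shows "1 - cmod a \<le> cmod (1 - cnj a * z)" "1 - cmod z \<le> cmod (1 - cnj a * z)"
proof -
  have "1 - cmod a * cmod z \<le> cmod (1 - cnj a * z)"
    using norm_triangle_ineq2[of 1 "cnj a * z"] by (simp add: norm_mult)
  moreover have "cmod a * cmod z \<le> cmod a" "cmod a * cmod z \<le> cmod z"
    using assms by (simp_all add: mult_left_le mult_left_le_one_le)
  ultimately show "1 - cmod a \<le> cmod (1 - cnj a * z)" "1 - cmod z \<le> cmod (1 - cnj a * z)"
    by linarith+
qed

lemma one_minus_cnj_mult_nonzero:
  assumes "cmod a < 1" "cmod z \<le> 1"
  shows "1 - cnj a * z \<noteq> 0"
  using one_minus_cmod_le(1)[of a z] assms by auto

lemma cmod_one_minus_sub:
  "(cmod (1 - cnj a * z))\<^sup>2 - (cmod (a - z))\<^sup>2 = (1 - (cmod a)\<^sup>2) * (1 - (cmod z)\<^sup>2)"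
  unfolding cmod_power2 by (simp add: power2_eq_square algebra_simps)

lemma one_minus_cmod_mob:
  assumes "cmod a < 1" "cmod z \<le> 1"
  shows "1 - (cmod (mob a z))\<^sup>2 = (1 - (cmod a)\<^sup>2) * (1 - (cmod z)\<^sup>2) / (cmod (1 - cnj a * z))\<^sup>2"
  using one_minus_cnj_mult_nonzero[OF assms] cmod_one_minus_sub[of a z]
  by (simp add: mob_def norm_divide power_divide field_simps)

lemma cmod_square_le_1: "cmod z \<le> 1 \<Longrightarrow> (cmod z)\<^sup>2 \<le> 1"
  by (simp add: abs_square_le_1)

lemma cmod_mob_le_1:
  assumes "cmod a < 1" "cmod z \<le> 1"
  shows "cmod (mob a z) \<le> 1"
proof -
  have "0 \<le> 1 - (cmod (mob a z))\<^sup>2"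
    unfolding one_minus_cmod_mob[OF assms] using assms by (simp add: cmod_square_le_1)
  then show ?thesis by (simp add: abs_square_le_1)
qed

lemma holomorphic_mob: "cmod a < 1 \<Longrightarrow> mob a holomorphic_on ball 0 1"
  unfolding mob_def[abs_def]
  by (intro holomorphic_intros) (use one_minus_cnj_mult_nonzero in \<open>auto simp: less_imp_le\<close>)

text \<open>A discrete version of integrating exp(-T). In order of decreasing \<open>r\<close>, with
  T the running total including the current t, the inequality 1 + t <= exp(t) gives t exp(-T) <=
  exp(-(T - t)) - exp(-T), and the right-hand sides telescope. The induction therefore adds an index
  of least \<open>r\<close> last.\<close>

lemma sum_exp_tail_le:
  fixes t r :: "'a \<Rightarrow> real"
  assumes "finite S" "\<And>k. k \<in> S \<Longrightarrow> t k \<ge> 0"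
  shows "(\<Sum>n\<in>S. t n * exp (- (\<Sum>k | k \<in> S \<and> r n \<le> r k. t k))) \<le> 1 - exp (- sum t S)"
  using assms
proof (induction S rule: finite_ranking_induct[where f = "\<lambda>k. - r k"])
  case empty
  then show ?case by simp
next
  case (insert x S)
  show ?case
  proof (cases "x \<in> S")
    case True
    then show ?thesis using insert by (simp add: insert_absorb)
  next
    case False
    have all: "{k. k \<in> insert x S \<and> r x \<le> r k} = insert x S"
      using insert(2) by auto
    \<comment> \<open>If \<open>r\<close> has ties, the new index also enters exponents of earlier
      terms, which only makes those terms smaller.\<close>
    have le: "t n * exp (- (\<Sum>k | k \<in> insert x S \<and> r n \<le> r k. t k))
        \<le> t n * exp (- (\<Sum>k | k \<in> S \<and> r n \<le> r k. t k))" if "n \<in> S" for n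
    proof -
      have "(\<Sum>k | k \<in> S \<and> r n \<le> r k. t k) \<le> (\<Sum>k | k \<in> insert x S \<and> r n \<le> r k. t k)"
        using insert by (intro sum_mono2) auto
      then show ?thesis using insert(4) that by (intro mult_left_mono) auto
    qed
    define T where "T = sum t S"
    have tx: "0 \<le> t x" using insert(4) by simp
    have "(\<Sum>n\<in>insert x S. t n * exp (- (\<Sum>k | k \<in> insert x S \<and> r n \<le> r k. t k)))
        = t x * exp (- (t x + T)) + (\<Sum>n\<in>S. t n * exp (- (\<Sum>k | k \<in> insert x S \<and> r n \<le> r k. t k)))"
      using False insert(1) by (simp add: all T_def del: insert_iff)
    also have "\<dots> \<le> t x * exp (- (t x + T)) + (1 - exp (- T))"
      using insert(3) insert(4) sum_mono[OF le] unfolding T_def by fastforce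
    also have "\<dots> \<le> 1 - exp (- (t x + T))"
    proof -
      have "(1 + t x) * exp (- (t x + T)) \<le> exp (t x) * exp (- (t x + T))"
        using exp_ge_add_one_self[of "t x"] by (intro mult_right_mono) auto
      also have "\<dots> = exp (- T)" by (simp flip: exp_add)
      finally show ?thesis by (simp add: algebra_simps)
    qed
    finally show ?thesis using False insert(1) by (simp add: T_def)
  qed
qed

text \<open>Jones' explicit formula; the exponential factors play the role of a summation by parts
  that turns the Carleson condition into an absolute bound.\<close>

lemma finite_interpolation:
  fixes lam \<epsilon> :: "nat \<Rightarrow> complex"
  assumes lam: "\<And>k. cmod (lam k) < 1" and \<delta>: "0 < \<delta>"
    and sep: "\<And>n. n < N \<Longrightarrow> \<delta> \<le> (\<Prod>k\<in>{..<N} - {n}. cmod (mob (lam k) (lam n)))"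
    and \<epsilon>: "\<And>n. cmod (\<epsilon> n) \<le> 1"
  obtains \<phi> where "\<phi> holomorphic_on ball 0 1" "\<And>n. n < N \<Longrightarrow> \<phi> (lam n) = \<epsilon> n"
    "\<And>z. cmod z < 1 \<Longrightarrow> cmod (\<phi> z) \<le> exp 2 / \<delta> ^ 5"
proof -
  define s where "s k = 1 - (cmod (lam k))\<^sup>2" for k
  define B where "B n z = (\<Prod>k\<in>{..<N} - {n}. mob (lam k) z)" for n z
  define W where "W k z = of_real (s k) * ((1 + cnj (lam k) * z) / (1 - cnj (lam k) * z))" for k z
  \<comment> \<open>Only nodes at least as close to the circle as \<open>lam n\<close> enter the
    exponent; for them 1 - |lam k|^2 |lam n|^2 is at most 2 (1 - |lam n|^2), which is what
    \<open>up\<close> relies on.\<close>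
  define U where "U n = {k. k \<in> {..<N} \<and> cmod (lam n) \<le> cmod (lam k)}" for n
  define D where "D n z = of_real (s n) / (1 - cnj (lam n) * z)" for n z
  \<comment> \<open>At \<open>lam n\<close> the exponent vanishes and both other factors are 1,
    while \<open>B n\<close> vanishes at the other nodes. The remaining factors serve only the size
    estimate.\<close>
  define F where "F n z = B n z / B n (lam n) * (D n z)\<^sup>2 * exp (\<Sum>k\<in>U n. W k (lam n) - W k z)" for n z
  define \<phi> where "\<phi> z = (\<Sum>n<N. \<epsilon> n * F n z)" for z
  have nz: "1 - cnj (lam k) * z \<noteq> 0" if "cmod z < 1" for k z
    using one_minus_cnj_mult_nonzero[OF lam] that by simp
  have l1: "(cmod (lam k))\<^sup>2 < 1" for k
    using lam by (simp add: abs_square_less_1)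
  have s0: "0 < s k" for k using l1[of k] by (simp add: s_def)
  have Bd: "\<delta> \<le> cmod (B n (lam n))" if "n < N" for n
    using sep[OF that] by (simp add: B_def prod_norm)
  have Bnz: "B n (lam n) \<noteq> 0" if "n < N" for n
    using Bd[OF that] \<delta> by auto
  have "\<phi> holomorphic_on ball 0 1"
    unfolding \<phi>_def F_def B_def D_def W_def
    by (intro holomorphic_intros holomorphic_on_prod holomorphic_mob lam)
       (use nz Bnz in \<open>auto simp: B_def\<close>)
  moreover have "\<phi> (lam m) = \<epsilon> m" if m: "m < N" for m
  proof -
    have "F n (lam m) = (if n = m then 1 else 0)" if n: "n < N" for n
    proof (cases "n = m")
      case True
      have "of_real (s m) = 1 - cnj (lam m) * lam m"
        by (simp only: s_def of_real_diff of_real_1 complex_norm_square mult.commute)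
      then have "D m (lam m) = 1"
        using nz[OF lam, of m m] by (simp add: D_def)
      then show ?thesis using True Bnz[OF m] by (simp add: F_def)
    next
      case False
      then have "B n (lam m) = 0"
        using m by (auto simp: B_def mob_def intro!: bexI[of _ m])
      then show ?thesis using False by (simp add: F_def)
    qed
    then have "\<phi> (lam m) = (\<Sum>n<N. if n = m then \<epsilon> n else 0)"
      unfolding \<phi>_def by (intro sum.cong) auto
    then show ?thesis using m by simp
  qed
  moreover have "cmod (\<phi> z) \<le> exp 2 / \<delta> ^ 5" if z: "cmod z < 1" for z
  proof -
    define t where "t k = (cmod (D k z))\<^sup>2" for k
    have ReW: "Re (W k w) = s k * (1 - (cmod (lam k))\<^sup>2 * (cmod w)\<^sup>2) / (cmod (1 - cnj (lam k) * w))\<^sup>2"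
      if "cmod w < 1" for k w
    proof -
      have "Re ((1 + c) / (1 - c)) = (1 - (cmod c)\<^sup>2) / (cmod (1 - c))\<^sup>2" for c
      proof -
        have "Re ((1 + c) / (1 - c)) = Re ((1 + c) * cnj (1 - c)) / (cmod (1 - c))\<^sup>2"
          by (subst complex_div_cnj) (simp only: of_real_power[symmetric] Re_divide_of_real)
        also have "Re ((1 + c) * cnj (1 - c)) = 1 - (cmod c)\<^sup>2"
          unfolding cmod_power2 by (simp add: power2_eq_square algebra_simps)
        finally show ?thesis .
      qed
      moreover have "Re (W k w) = s k * Re ((1 + cnj (lam k) * w) / (1 - cnj (lam k) * w))"
        unfolding W_def by (simp only: times_complex.sel Re_complex_of_real Im_complex_of_real mult_zero_left diff_zero)
      ultimately show ?thesis
        by (simp add: norm_mult power_mult_distrib)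
    qed
    \<comment> \<open>This damping feeds \<open>sum_exp_tail_le\<close>: the weight
      \<open>t n\<close> there is the modulus of the squared factor \<open>D n z\<close>, and the
      exponent comes from the real parts of the \<open>W k z\<close>.\<close>
    have low: "t k \<le> Re (W k z)" for k
    proof -
      have "(cmod (lam k))\<^sup>2 * (cmod z)\<^sup>2 \<le> (cmod (lam k))\<^sup>2"
        using z by (intro mult_left_le) (auto simp: cmod_square_le_1)
      then have "s k * s k \<le> s k * (1 - (cmod (lam k))\<^sup>2 * (cmod z)\<^sup>2)"
        using s0[of k] by (intro mult_left_mono) (auto simp: s_def)
      moreover have "t k = s k * s k / (cmod (1 - cnj (lam k) * z))\<^sup>2"
        by (simp add: t_def D_def norm_divide power_divide power2_eq_square)
      ultimately show ?thesis
        unfolding ReW[OF z] by (simp add: divide_right_mono)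
    qed
    \<comment> \<open>The term \<open>k = n\<close> contributes at most 2. Every other one is at
      most -4 times the logarithm of its Moebius modulus, by 1 - y <= - ln y for the squared modulus
      y, and these logarithms add up to that of the separation product.\<close>
    have up: "(\<Sum>k\<in>U n. Re (W k (lam n))) \<le> 2 - 4 * ln \<delta>" if n: "n < N" for n
    proof -
      have one: "Re (W k (lam n)) \<le> 2 * (1 - (cmod (mob (lam k) (lam n)))\<^sup>2)" if k: "k \<in> U n" for k
      proof -
        have "(cmod (lam n))\<^sup>2 \<le> (cmod (lam k))\<^sup>2"
          using k by (intro power_mono) (auto simp: U_def)
        then have "(cmod (lam n))\<^sup>2 * (cmod (lam n))\<^sup>2 \<le> (cmod (lam k))\<^sup>2 * (cmod (lam n))\<^sup>2"
          by (intro mult_right_mono) auto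
        moreover have "0 \<le> (1 - (cmod (lam n))\<^sup>2) * (1 - (cmod (lam n))\<^sup>2)" by simp
        ultimately have "1 - (cmod (lam k))\<^sup>2 * (cmod (lam n))\<^sup>2 \<le> 2 * (1 - (cmod (lam n))\<^sup>2)"
          by (simp add: algebra_simps)
        then have "s k * (1 - (cmod (lam k))\<^sup>2 * (cmod (lam n))\<^sup>2) \<le> s k * (2 * (1 - (cmod (lam n))\<^sup>2))"
          using s0[of k] by (intro mult_left_mono) auto
        then have "Re (W k (lam n)) \<le> s k * (2 * (1 - (cmod (lam n))\<^sup>2)) / (cmod (1 - cnj (lam k) * lam n))\<^sup>2"
          unfolding ReW[OF lam] by (intro divide_right_mono) auto
        also have "\<dots> = 2 * (1 - (cmod (mob (lam k) (lam n)))\<^sup>2)"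
          unfolding one_minus_cmod_mob[OF lam less_imp_le[OF lam]] by (simp add: s_def mult_ac)
        finally show ?thesis .
      qed
      have pos: "0 < cmod (mob (lam k) (lam n))" if k: "k \<in> {..<N} - {n}" for k
      proof (rule ccontr)
        assume "\<not> 0 < cmod (mob (lam k) (lam n))"
        then have "(\<Prod>k\<in>{..<N} - {n}. cmod (mob (lam k) (lam n))) = 0"
          using k by (auto intro!: bexI[of _ k])
        then show False using sep[OF n] \<delta> by linarith
      qed
      have lnb: "2 * (1 - (cmod (mob (lam k) (lam n)))\<^sup>2) \<le> - 4 * ln (cmod (mob (lam k) (lam n)))"
        if k: "k \<in> {..<N} - {n}" for k
        using ln_le_minus_one[of "(cmod (mob (lam k) (lam n)))\<^sup>2"] pos[OF k]
        by (simp add: ln_realpow)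
      have nU: "n \<in> U n" using n by (simp add: U_def)
      have "(\<Sum>k\<in>U n. Re (W k (lam n))) \<le> (\<Sum>k\<in>U n. 2 * (1 - (cmod (mob (lam k) (lam n)))\<^sup>2))"
        by (intro sum_mono one)
      also have "\<dots> = 2 + (\<Sum>k\<in>U n - {n}. 2 * (1 - (cmod (mob (lam k) (lam n)))\<^sup>2))"
        using nU by (subst sum.remove[of _ n]) (auto simp: U_def mob_def)
      also have "(\<Sum>k\<in>U n - {n}. 2 * (1 - (cmod (mob (lam k) (lam n)))\<^sup>2))
          \<le> (\<Sum>k\<in>{..<N} - {n}. 2 * (1 - (cmod (mob (lam k) (lam n)))\<^sup>2))"
        by (intro sum_mono2) (use cmod_mob_le_1[OF lam less_imp_le[OF lam]] in \<open>auto simp: U_def cmod_square_le_1\<close>)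
      also have "\<dots> \<le> (\<Sum>k\<in>{..<N} - {n}. - 4 * ln (cmod (mob (lam k) (lam n))))"
        by (intro sum_mono lnb)
      also have "\<dots> = - 4 * ln (\<Prod>k\<in>{..<N} - {n}. cmod (mob (lam k) (lam n)))"
        using pos by (subst ln_prod) (auto simp: sum_distrib_left)
      also have "\<dots> \<le> - 4 * ln \<delta>"
        using sep[OF n] \<delta> by simp
      finally show ?thesis by simp
    qed
    \<comment> \<open>The power \<open>\<delta> ^ 5\<close> collects one factor from normalizing
      \<open>B n\<close> at \<open>lam n\<close> and four from the exponential of the bound
      \<open>up\<close>.\<close>
    have Fb: "cmod (F n z) \<le> exp 2 / \<delta> ^ 5 * (t n * exp (- (\<Sum>k\<in>U n. t k)))" if n: "n < N" for n
    proof -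
      have "cmod (B n z) \<le> 1"
        unfolding B_def prod_norm[symmetric]
        by (intro prod_le_1) (use z in \<open>auto intro: cmod_mob_le_1[OF lam]\<close>)
      then have b: "cmod (B n z) / cmod (B n (lam n)) \<le> 1 / \<delta>"
        using Bd[OF n] \<delta> by (intro frac_le) auto
      have "cmod (exp (\<Sum>k\<in>U n. W k (lam n) - W k z)) = exp ((\<Sum>k\<in>U n. Re (W k (lam n))) - (\<Sum>k\<in>U n. Re (W k z)))"
        by (simp add: norm_exp_eq_Re sum_subtractf)
      also have "\<dots> \<le> exp ((2 - 4 * ln \<delta>) - (\<Sum>k\<in>U n. t k))"
        using up[OF n] sum_mono[of "U n" t "\<lambda>k. Re (W k z)"] low by (simp add: diff_mono)
      also have "\<dots> = exp 2 / exp (4 * ln \<delta>) * exp (- (\<Sum>k\<in>U n. t k))"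
        by (simp add: exp_diff exp_minus exp_add field_simps)
      also have "exp (4 * ln \<delta>) = \<delta> ^ 4"
        using \<delta> by (simp flip: powr_realpow add: powr_def)
      finally have e: "cmod (exp (\<Sum>k\<in>U n. W k (lam n) - W k z)) \<le> exp 2 / \<delta> ^ 4 * exp (- (\<Sum>k\<in>U n. t k))" .
      have "cmod (F n z) = (cmod (B n z) / cmod (B n (lam n))) * t n * cmod (exp (\<Sum>k\<in>U n. W k (lam n) - W k z))"
        by (simp add: F_def norm_mult norm_divide norm_power t_def del: norm_exp_eq_Re)
      also have "\<dots> \<le> (1 / \<delta>) * t n * (exp 2 / \<delta> ^ 4 * exp (- (\<Sum>k\<in>U n. t k)))"
        using b e \<delta> by (intro mult_mono) (auto simp: t_def)
      also have "\<dots> = exp 2 / \<delta> ^ 5 * (t n * exp (- (\<Sum>k\<in>U n. t k)))"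
        by (simp add: eval_nat_numeral field_simps)
      finally show ?thesis .
    qed
    have "cmod (\<phi> z) \<le> (\<Sum>n<N. cmod (F n z))"
      unfolding \<phi>_def
      by (intro order_trans[OF norm_sum] sum_mono) (simp add: norm_mult mult_left_le_one_le \<epsilon>)
    also have "\<dots> \<le> (\<Sum>n<N. exp 2 / \<delta> ^ 5 * (t n * exp (- (\<Sum>k\<in>U n. t k))))"
      by (intro sum_mono Fb) simp
    also have "\<dots> = exp 2 / \<delta> ^ 5 * (\<Sum>n<N. t n * exp (- (\<Sum>k\<in>U n. t k)))"
      by (simp add: sum_distrib_left)
    also have "\<dots> \<le> exp 2 / \<delta> ^ 5 * 1"
    proof (rule mult_left_mono)
      have "(\<Sum>n<N. t n * exp (- (\<Sum>k\<in>U n. t k))) \<le> 1 - exp (- sum t {..<N})"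
        unfolding U_def by (rule sum_exp_tail_le) (auto simp: t_def)
      then show "(\<Sum>n<N. t n * exp (- (\<Sum>k\<in>U n. t k))) \<le> 1"
        by (rule order_trans) simp
    qed (use \<delta> in simp)
    finally show ?thesis by simp
  qed
  ultimately show ?thesis by (rule that)
qed

section \<open>Normalized reproducing kernels form a Riesz sequence\<close>

text \<open>A greedy choice replaces the average: each new sign gives the cross term the favourable
  sign. The parameter \<open>\<tau>\<close> treats both directions at once, \<open>1\<close> giving
  a small signed sum and \<open>-1\<close> a large one.\<close>

lemma exists_signs:
  fixes v :: "'i \<Rightarrow> 'a::real_inner" and \<tau> :: real
  assumes "finite A" "\<tau> \<in> {1, -1}"
  shows "\<exists>\<sigma>. (\<forall>i. \<sigma> i \<in> {1, -1}) \<and>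
    \<tau> * (norm (\<Sum>i\<in>A. \<sigma> i *\<^sub>R v i))\<^sup>2 \<le> \<tau> * (\<Sum>i\<in>A. (norm (v i))\<^sup>2)"
  using assms(1)
proof induction
  case empty
  show ?case by (rule exI[of _ "\<lambda>_. 1"]) simp
next
  case (insert x F)
  then obtain \<sigma> :: "'i \<Rightarrow> real" where \<sigma>: "\<And>i. \<sigma> i \<in> {1, -1}"
    "\<tau> * (norm (\<Sum>i\<in>F. \<sigma> i *\<^sub>R v i))\<^sup>2 \<le> \<tau> * (\<Sum>i\<in>F. (norm (v i))\<^sup>2)" by blast
  define u where "u = (\<Sum>i\<in>F. \<sigma> i *\<^sub>R v i)"
  define s :: real where "s = (if \<tau> * inner u (v x) \<le> 0 then 1 else -1)"
  have s: "s \<in> {1, -1}" "s * s = 1" "\<tau> * (s * inner u (v x)) \<le> 0"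
    by (auto simp: s_def)
  have eq: "(\<Sum>i\<in>insert x F. (\<sigma>(x := s)) i *\<^sub>R v i) = s *\<^sub>R v x + u"
    using insert(1,2) by (auto simp: u_def intro!: sum.cong)
  have "(norm (s *\<^sub>R v x + u))\<^sup>2 = (s * s) * (norm (v x))\<^sup>2 + 2 * (s * inner u (v x)) + (norm u)\<^sup>2"
    by (simp add: power2_norm_eq_inner inner_add_left inner_add_right inner_commute algebra_simps)
  then have "\<tau> * (norm (s *\<^sub>R v x + u))\<^sup>2 = \<tau> * (norm (v x))\<^sup>2 + 2 * (\<tau> * (s * inner u (v x))) + \<tau> * (norm u)\<^sup>2"
    using s(2) by (simp add: algebra_simps)
  also have "\<dots> \<le> \<tau> * (norm (v x))\<^sup>2 + \<tau> * (\<Sum>i\<in>F. (norm (v i))\<^sup>2)"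
    using s(3) \<sigma>(2) by (simp add: u_def)
  finally show ?case
    using insert(1,2) \<sigma>(1) s(1) unfolding eq[symmetric]
    by (intro exI[of _ "\<sigma>(x := s)"]) (auto simp: distrib_left)
qed

lemma cscale_cscale [simp]: "cscale a (cscale b u) = cscale (a * b) u"
  by (rule l2_eqI) (simp add: mult.assoc)

lemma cscale_add: "cscale (a + b) u = cscale a u + cscale b u"
  by (rule l2_eqI) (simp add: algebra_simps)

lemma cscale_diff: "cscale (a - b) u = cscale a u - cscale b u"
  by (rule l2_eqI) (simp add: algebra_simps)

lemma cscale_sum: "cscale c (\<Sum>i\<in>A. f i) = (\<Sum>i\<in>A. cscale c (f i))"
  by (rule l2_eqI) (simp add: sum_distrib_left)

lemma cscale_zero [simp]: "cscale 0 u = 0" "cscale c 0 = 0"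
  by (rule l2_eqI; simp)+

lemma cscale_one [simp]: "cscale 1 u = u"
  by (rule l2_eqI) simp

lemma scaleR_conv_cscale: "r *\<^sub>R u = cscale (of_real r) u"
  by (rule l2_eqI) simp

lemma inner_cscale_ker: "cmod a < 1 \<Longrightarrow> inner u (cscale c (ker a)) = Re (cnj c * ev u a)"
  by (simp only: Re_cinner[symmetric] cinner_cscale_right cinner_ker)

text \<open>The adjoint of multiplication by \<open>\<phi>\<close> maps the kernel at \<open>a\<close> to its multiple by the conjugate
  of \<open>\<phi> a\<close>, and its norm is at most \<open>M\<close>.\<close>

lemma norm_sum_signed_kernels_le:
  fixes lam c :: "nat \<Rightarrow> complex" and \<epsilon> :: "nat \<Rightarrow> real"
  assumes lam: "\<And>k. cmod (lam k) < 1" and hol: "\<phi> holomorphic_on ball 0 1"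
    and M: "\<And>z. cmod z < 1 \<Longrightarrow> cmod (\<phi> z) \<le> M"
    and \<phi>: "\<And>n. n < N \<Longrightarrow> \<phi> (lam n) = of_real (\<epsilon> n)"
  shows "norm (\<Sum>n<N. \<epsilon> n *\<^sub>R cscale (c n) (ker (lam n))) \<le> M * norm (\<Sum>n<N. cscale (c n) (ker (lam n)))"
proof -
  define v where "v = (\<Sum>n<N. cscale (c n) (ker (lam n)))"
  define u where "u = (\<Sum>n<N. \<epsilon> n *\<^sub>R cscale (c n) (ker (lam n)))"
  define q where "q z = \<phi> z * ev u z" for z
  have M0: "0 \<le> M" using M[of 0] by (rule order_trans[OF norm_ge_zero]) simp
  have qb: "cmod (q z) \<le> M * cmod (ev u z)" if "cmod z < 1" for z
    using M[OF that] by (simp add: q_def norm_mult mult_right_mono)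
  have qhol: "q holomorphic_on ball 0 1"
    unfolding q_def by (intro holomorphic_intros hol holomorphic_ev)
  have q: "q \<in> H2" "norm (taylor q) \<le> M * norm u"
    using H2_dominated[OF qhol ev_in_H2[of u], of 0 M] M0 qb by simp_all
  \<comment> \<open>Pairing \<open>u\<close> with itself moves the signs onto the values of \<phi>
    times \<open>ev u\<close> at the nodes. One factor \<open>norm u\<close> then cancels.\<close>
  have "(norm u)\<^sup>2 = inner u u" by (simp add: power2_norm_eq_inner)
  also have "\<dots> = (\<Sum>n<N. \<epsilon> n * Re (cnj (c n) * ev u (lam n)))"
    by (subst (2) u_def) (simp add: inner_sum_right inner_cscale_ker lam)
  also have "\<dots> = (\<Sum>n<N. Re (cnj (c n) * ev (taylor q) (lam n)))"
    using lam by (intro sum.cong) (simp_all add: ev_taylor[OF q(1)] q_def \<phi> algebra_simps)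
  also have "\<dots> = inner (taylor q) v"
    by (simp add: v_def inner_sum_right inner_cscale_ker lam)
  also have "\<dots> \<le> norm (taylor q) * norm v" by (rule norm_cauchy_schwarz)
  also have "\<dots> \<le> M * norm u * norm v" using q(2) by (rule mult_right_mono) simp
  finally have "norm u * norm u \<le> norm u * (M * norm v)"
    by (simp add: power2_eq_square mult_ac)
  then have "norm u \<le> M * norm v"
    using M0 by (cases "norm u = 0") auto
  then show ?thesis by (simp add: u_def v_def)
qed

definition unit_ker :: "complex \<Rightarrow> l2" where
  "unit_ker a = cscale (of_real (sqrt (1 - (cmod a)\<^sup>2))) (ker a)"

lemma norm_unit_ker: "cmod a < 1 \<Longrightarrow> norm (unit_ker a) = 1"
proof -
  assume a: "cmod a < 1"
  then have p: "0 < 1 - (cmod a)\<^sup>2" by (simp add: abs_square_less_1)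
  have "(norm (unit_ker a))\<^sup>2 = (1 - (cmod a)\<^sup>2) * (norm (ker a))\<^sup>2"
    using p by (simp add: unit_ker_def power_mult_distrib)
  also have "\<dots> = 1" using p by (simp add: norm_ker[OF a])
  finally show ?thesis by (simp add: power2_eq_1_iff) (use norm_ge_zero[of "unit_ker a"] in linarith)
qed

locale interpolating =
  fixes lam :: "nat \<Rightarrow> complex"
  assumes interpolating: "interpolating_seq lam"
begin

lemma lam: "cmod (lam n) < 1"
  and inj_lam: "inj lam"
  and summable_lam: "summable (\<lambda>n. 1 - cmod (lam n))"
  using interpolating by (auto simp: interpolating_seq_def)

text \<open>The interpolation bound depends on the separation constant alone, so a single
  \<open>M\<close> serves all lengths, signs and coefficients.\<close>

lemma ex_sign_bound:
  "\<exists>M\<ge>0. \<forall>N \<epsilon> c. (\<forall>n. \<epsilon> n \<in> {1, -1::real}) \<longrightarrow>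
     norm (\<Sum>n<N. \<epsilon> n *\<^sub>R cscale (c n) (ker (lam n))) \<le> M * norm (\<Sum>n<N. cscale (c n) (ker (lam n)))"
proof -
  obtain \<delta> where \<delta>: "\<delta> > 0"
    and sep: "\<And>n N. \<delta> \<le> (\<Prod>k\<in>{..<N} - {n}. cmod ((lam n - lam k) / (1 - cnj (lam k) * lam n)))"
    using interpolating by (auto simp: interpolating_seq_def)
  have sep': "\<delta> \<le> (\<Prod>k\<in>{..<N} - {n}. cmod (mob (lam k) (lam n)))" for n N
    using sep[where n = n and N = N] by (simp add: mob_def norm_divide norm_minus_commute)
  show ?thesis
  proof (intro exI[of _ "exp 2 / \<delta> ^ 5"] conjI allI impI)
    show "0 \<le> exp 2 / \<delta> ^ 5" using \<delta> by simp
    fix N and \<epsilon> :: "nat \<Rightarrow> real" and c :: "nat \<Rightarrow> complex"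
    assume \<epsilon>: "\<forall>n. \<epsilon> n \<in> {1, -1}"
    show "norm (\<Sum>n<N. \<epsilon> n *\<^sub>R cscale (c n) (ker (lam n))) \<le> exp 2 / \<delta> ^ 5 * norm (\<Sum>n<N. cscale (c n) (ker (lam n)))"
    proof (rule finite_interpolation[of lam \<delta> N "\<lambda>n. of_real (\<epsilon> n)"])
      show "cmod (lam k) < 1" for k by (rule lam)
      show "0 < \<delta>" by (rule \<delta>)
      show "\<delta> \<le> (\<Prod>k\<in>{..<N} - {n}. cmod (mob (lam k) (lam n)))" for n by (rule sep')
      show "cmod (of_real (\<epsilon> n)) \<le> 1" for n
        using \<epsilon>[rule_format, of n] by auto
      fix \<phi>
      assume "\<phi> holomorphic_on ball 0 1" "\<And>n. n < N \<Longrightarrow> \<phi> (lam n) = of_real (\<epsilon> n)"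
        "\<And>z. cmod z < 1 \<Longrightarrow> cmod (\<phi> z) \<le> exp 2 / \<delta> ^ 5"
      from norm_sum_signed_kernels_le[OF lam this(1,3,2)] show ?thesis .
    qed
  qed
qed

abbreviation x :: "nat \<Rightarrow> l2" where "x n \<equiv> unit_ker (lam n)"

text \<open>For suitable signs either inequality holds with constant 1, as if the unit vectors
  \<open>x n\<close> were orthogonal. Changing the signs costs a factor \<open>M\<close> in norm in
  either direction, since a sign change is its own inverse.\<close>

lemma riesz_bounds:
  obtains M where "M \<ge> 0"
    "\<And>N a. (norm (\<Sum>n<N. cscale (a n) (x n)))\<^sup>2 \<le> M * (\<Sum>n<N. (cmod (a n))\<^sup>2)"
    "\<And>N a. (\<Sum>n<N. (cmod (a n))\<^sup>2) \<le> M * (norm (\<Sum>n<N. cscale (a n) (x n)))\<^sup>2"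
proof -
  obtain M where M0: "M \<ge> 0" and M: "\<And>N \<epsilon> c. (\<And>n. \<epsilon> n \<in> {1, -1::real}) \<Longrightarrow>
     norm (\<Sum>n<N. \<epsilon> n *\<^sub>R cscale (c n) (ker (lam n))) \<le> M * norm (\<Sum>n<N. cscale (c n) (ker (lam n)))"
    using ex_sign_bound by blast
  have Mx: "norm (\<Sum>n<N. \<epsilon> n *\<^sub>R cscale (a n) (x n)) \<le> M * norm (\<Sum>n<N. cscale (a n) (x n))"
    if "\<And>n. \<epsilon> n \<in> {1, -1}" for N a and \<epsilon> :: "nat \<Rightarrow> real"
    unfolding unit_ker_def cscale_cscale by (rule M[OF that])
  have nx: "norm (cscale (a n) (x n)) = cmod (a n)" for a n
    by (simp add: norm_unit_ker lam)
  show ?thesis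
  proof (rule that[of "M\<^sup>2"])
    fix N and a :: "nat \<Rightarrow> complex"
    obtain \<sigma> where \<sigma>: "\<forall>n. \<sigma> n \<in> {1, -1::real}"
      "(norm (\<Sum>n<N. \<sigma> n *\<^sub>R cscale (a n) (x n)))\<^sup>2 \<le> (\<Sum>n<N. (cmod (a n))\<^sup>2)"
      using exists_signs[of "{..<N}" 1 "\<lambda>n. cscale (a n) (x n)"] by (auto simp only: nx mult_1)
    \<comment> \<open>The given sum is the sign change of the favourable one, so \<open>Mx\<close>
      applies with coefficients already multiplied by \<open>\<sigma>\<close>.\<close>
    have "\<sigma> n * \<sigma> n = 1" for n using \<sigma>(1)[rule_format, of n] by auto
    then have "(\<Sum>n<N. cscale (a n) (x n)) = (\<Sum>n<N. \<sigma> n *\<^sub>R cscale (of_real (\<sigma> n) * a n) (x n))"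
      by (simp add: scaleR_conv_cscale flip: mult.assoc of_real_mult)
    then have "norm (\<Sum>n<N. cscale (a n) (x n)) \<le> M * norm (\<Sum>n<N. cscale (of_real (\<sigma> n) * a n) (x n))"
      using Mx[of \<sigma> "\<lambda>n. of_real (\<sigma> n) * a n" N] \<sigma>(1) by simp
    also have "(\<Sum>n<N. cscale (of_real (\<sigma> n) * a n) (x n)) = (\<Sum>n<N. \<sigma> n *\<^sub>R cscale (a n) (x n))"
      by (simp add: scaleR_conv_cscale)
    finally have "(norm (\<Sum>n<N. cscale (a n) (x n)))\<^sup>2 \<le> (M * norm (\<Sum>n<N. \<sigma> n *\<^sub>R cscale (a n) (x n)))\<^sup>2"
      by (rule power_mono) simp
    also have "\<dots> \<le> M\<^sup>2 * (\<Sum>n<N. (cmod (a n))\<^sup>2)"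
      using \<sigma>(2) by (simp add: power_mult_distrib mult_left_mono)
    finally show "(norm (\<Sum>n<N. cscale (a n) (x n)))\<^sup>2 \<le> M\<^sup>2 * (\<Sum>n<N. (cmod (a n))\<^sup>2)" .
  next
    fix N and a :: "nat \<Rightarrow> complex"
    obtain \<sigma> where \<sigma>: "\<forall>n. \<sigma> n \<in> {1, -1::real}"
      "- 1 * (norm (\<Sum>n<N. \<sigma> n *\<^sub>R cscale (a n) (x n)))\<^sup>2 \<le> - 1 * (\<Sum>n<N. (cmod (a n))\<^sup>2)"
      using exists_signs[of "{..<N}" "-1" "\<lambda>n. cscale (a n) (x n)"] by (auto simp only: nx)
    then have "(\<Sum>n<N. (cmod (a n))\<^sup>2) \<le> (norm (\<Sum>n<N. \<sigma> n *\<^sub>R cscale (a n) (x n)))\<^sup>2"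
      by simp
    also have "\<dots> \<le> (M * norm (\<Sum>n<N. cscale (a n) (x n)))\<^sup>2"
      using Mx[of \<sigma> a N] \<sigma>(1) by (intro power_mono) auto
    finally show "(\<Sum>n<N. (cmod (a n))\<^sup>2) \<le> M\<^sup>2 * (norm (\<Sum>n<N. cscale (a n) (x n)))\<^sup>2"
      by (simp add: power_mult_distrib)
  qed simp
qed

lemma convergent_unit_ker_series:
  assumes "summable (\<lambda>n. (cmod (a n))\<^sup>2)"
  shows "convergent (\<lambda>N. \<Sum>n<N. cscale (a n) (x n))"
proof -
  obtain M where M: "M \<ge> 0"
    "\<And>N a. (norm (\<Sum>n<N. cscale (a n) (x n)))\<^sup>2 \<le> M * (\<Sum>n<N. (cmod (a n))\<^sup>2)"
    "\<And>N a. (\<Sum>n<N. (cmod (a n))\<^sup>2) \<le> M * (norm (\<Sum>n<N. cscale (a n) (x n)))\<^sup>2"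
    by (fact riesz_bounds)
  have "summable (\<lambda>n. cscale (a n) (x n))"
    unfolding summable_Cauchy
  proof (intro allI impI)
    fix e :: real assume "e > 0"
    then have "e\<^sup>2 / (M + 1) > 0" using M(1) by simp
    then obtain K where K: "\<And>m n. m \<ge> K \<Longrightarrow> norm (\<Sum>k=m..<n. (cmod (a k))\<^sup>2) < e\<^sup>2 / (M + 1)"
      using assms unfolding summable_Cauchy by blast
    show "\<exists>K. \<forall>m\<ge>K. \<forall>n. norm (\<Sum>k=m..<n. cscale (a k) (x k)) < e"
    proof (intro exI[of _ K] allI impI)
      fix m n assume "m \<ge> K"
      \<comment> \<open>Padding with zeros turns the block from \<open>m\<close> to \<open>n\<close>
        into an initial segment, the form covered by the Riesz bounds.\<close>
      define b where "b k = (if m \<le> k then a k else 0)" for k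
      have res: "(\<Sum>k<n. if m \<le> k then f k else 0) = (\<Sum>k=m..<n. f k)" for f :: "nat \<Rightarrow> 'b::comm_monoid_add"
        by (rule sum.mono_neutral_cong_right) auto
      have "(\<Sum>k<n. cscale (b k) (x k)) = (\<Sum>k<n. if m \<le> k then cscale (a k) (x k) else 0)"
        by (intro sum.cong) (auto simp: b_def)
      then have 1: "(\<Sum>k<n. cscale (b k) (x k)) = (\<Sum>k=m..<n. cscale (a k) (x k))"
        by (simp only: res)
      have "(\<Sum>k<n. (cmod (b k))\<^sup>2) = (\<Sum>k<n. if m \<le> k then (cmod (a k))\<^sup>2 else 0)"
        by (intro sum.cong) (auto simp: b_def)
      then have 2: "(\<Sum>k<n. (cmod (b k))\<^sup>2) = (\<Sum>k=m..<n. (cmod (a k))\<^sup>2)"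
        by (simp only: res)
      have "(norm (\<Sum>k=m..<n. cscale (a k) (x k)))\<^sup>2 \<le> M * (\<Sum>k=m..<n. (cmod (a k))\<^sup>2)"
        using M(2)[where N = n and a = b] by (simp only: 1 2)
      also have "\<dots> \<le> M * (e\<^sup>2 / (M + 1))"
        using K[OF \<open>m \<ge> K\<close>, of n] M(1) by (intro mult_left_mono) (auto simp: sum_nonneg)
      also have "\<dots> < e\<^sup>2"
        using \<open>e > 0\<close> M(1) by (simp add: field_simps)
      finally show "norm (\<Sum>k=m..<n. cscale (a k) (x k)) < e"
        using \<open>e > 0\<close> by (rule power2_less_imp_less[OF _ less_imp_le])
    qed
  qed
  then show ?thesis by (simp add: summable_iff_convergent)
qed

end

section \<open>Blaschke products and division\<close>

lemma bfactor_eq_mob: "\<exists>c. cmod c = 1 \<and> (\<forall>z. bfactor a z = c * mob a z)"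
proof (cases "a = 0")
  case True
  then show ?thesis by (intro exI[of _ "-1"]) (simp add: bfactor_def mob_def)
next
  case False
  then show ?thesis
    by (intro exI[of _ "of_real (cmod a) / a"]) (simp add: bfactor_def mob_def norm_divide)
qed

lemma cmod_bfactor: "cmod (bfactor a z) = cmod (mob a z)"
  using bfactor_eq_mob[of a] by (auto simp: norm_mult)

lemma bfactor_eq_0_iff:
  assumes "cmod a < 1" "cmod z < 1"
  shows "bfactor a z = 0 \<longleftrightarrow> z = a"
proof -
  have "bfactor a z = 0 \<longleftrightarrow> mob a z = 0" using cmod_bfactor[of a z] by (metis norm_eq_zero)
  then show ?thesis
    using one_minus_cnj_mult_nonzero[OF assms(1) less_imp_le[OF assms(2)]] by (auto simp: mob_def)
qed

lemma holomorphic_bfactor: "cmod a < 1 \<Longrightarrow> bfactor a holomorphic_on ball 0 1"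
proof -
  assume a: "cmod a < 1"
  obtain c where "\<And>z. bfactor a z = c * mob a z" using bfactor_eq_mob by blast
  then have "bfactor a = (\<lambda>z. c * mob a z)" by blast
  then show ?thesis using holomorphic_mob[OF a] by (auto intro: holomorphic_intros)
qed

text \<open>Through this estimate the Blaschke condition yields absolute convergence of the product
  at each point. The factor 1 - |a| appears because r (a - z) - a (1 - conj(a) z) = -(1 - r)(a + r
  z) for r = |a|.\<close>

lemma cmod_bfactor_minus_1_le:
  assumes a: "cmod a < 1" and z: "cmod z < 1"
  shows "cmod (bfactor a z - 1) \<le> 2 / (1 - cmod z) * (1 - cmod a)"
proof (cases "a = 0")
  case True
  have "cmod (z - 1) \<le> 2" using norm_triangle_ineq4[of z 1] z by simp
  also have "2 \<le> 2 / (1 - cmod z)" using z by (simp add: field_simps)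
  finally show ?thesis using True by (simp add: bfactor_def)
next
  case False
  define r where "r = cmod a"
  have nz: "1 - cnj a * z \<noteq> 0" using one_minus_cnj_mult_nonzero[of a z] a z by simp
  have rr: "cnj a * a = of_real r * of_real r"
    by (simp only: r_def mult.commute[of "cnj a"] complex_norm_square[symmetric] power2_eq_square of_real_mult)
  have "bfactor a z - 1 = (of_real r * (a - z) - a * (1 - cnj a * z)) / (a * (1 - cnj a * z))"
    using False nz by (simp add: bfactor_def r_def field_simps)
  also have "of_real r * (a - z) - a * (1 - cnj a * z) = of_real r * a - of_real r * z - a + (cnj a * a) * z"
    by (simp add: algebra_simps)
  also have "\<dots> = - (of_real (1 - r) * (a + of_real r * z))"
    unfolding rr by (simp add: algebra_simps)
  finally have "cmod (bfactor a z - 1) = (1 - r) * cmod (a + of_real r * z) / (r * cmod (1 - cnj a * z))"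
    using a by (simp add: norm_divide norm_mult r_def del: of_real_diff)
  also have "\<dots> \<le> (1 - r) * (2 * r) / (r * (1 - cmod z))"
  proof (rule frac_le)
    have "cmod (a + of_real r * z) \<le> r + r * cmod z"
      using norm_triangle_ineq[of a "of_real r * z"] by (simp add: norm_mult r_def)
    also have "\<dots> \<le> 2 * r" using z mult_left_le[of "cmod z" r] by (simp add: r_def)
    finally show "(1 - r) * cmod (a + of_real r * z) \<le> (1 - r) * (2 * r)"
      using a by (intro mult_left_mono) (auto simp: r_def)
    show "r * (1 - cmod z) \<le> r * cmod (1 - cnj a * z)"
      using one_minus_cmod_le(2)[of a z] a z by (intro mult_left_mono) (auto simp: r_def)
  qed (use a z False in \<open>auto simp: r_def\<close>)
  also have "\<dots> = 2 / (1 - cmod z) * (1 - cmod a)"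
    using False by (simp add: r_def)
  finally show ?thesis .
qed

lemma cmod_mob_lower_bound:
  assumes a: "cmod a < 1" and C: "1 < C"
  obtains R where "R < 1" "\<And>z. R < cmod z \<Longrightarrow> cmod z < 1 \<Longrightarrow> 1 \<le> C * cmod (mob a z)"
proof -
  \<comment> \<open>Chosen so that 1 - |z|^2 <= \<kappa> forces 1 - |mob a z|^2 <= 1 - 1 /
    C^2.\<close>
  define \<kappa> where "\<kappa> = (1 - cmod a)\<^sup>2 * (1 - 1 / C\<^sup>2)"
  have C2: "1 < C\<^sup>2" using C by (simp add: one_less_power)
  have \<kappa>: "0 < \<kappa>" unfolding \<kappa>_def using a C2 by (intro mult_pos_pos) (auto simp: divide_simps)
  show ?thesis
  proof (rule that[of "sqrt (1 - \<kappa>)"])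
    show "sqrt (1 - \<kappa>) < 1" using \<kappa> by simp
    fix z assume z: "sqrt (1 - \<kappa>) < cmod z" "cmod z < 1"
    have "1 - \<kappa> < (cmod z)\<^sup>2" using real_le_rsqrt[of "cmod z" "1 - \<kappa>"] z(1) by linarith
    then have k: "1 - (cmod z)\<^sup>2 \<le> \<kappa>" by simp
    have "1 - (cmod (mob a z))\<^sup>2 = (1 - (cmod a)\<^sup>2) * (1 - (cmod z)\<^sup>2) / (cmod (1 - cnj a * z))\<^sup>2"
      using one_minus_cmod_mob[OF a, of z] z by simp
    also have "\<dots> \<le> 1 * \<kappa> / (1 - cmod a)\<^sup>2"
    proof (rule frac_le)
      show "(1 - (cmod a)\<^sup>2) * (1 - (cmod z)\<^sup>2) \<le> 1 * \<kappa>"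
        using k z a by (intro mult_mono) (auto simp: cmod_square_le_1)
      show "(1 - cmod a)\<^sup>2 \<le> (cmod (1 - cnj a * z))\<^sup>2"
        using one_minus_cmod_le(1)[of a z] a z by (intro power_mono) auto
    qed (use \<kappa> a in auto)
    also have "\<dots> = 1 - 1 / C\<^sup>2" using a by (simp add: \<kappa>_def)
    finally have "1 / C\<^sup>2 \<le> (cmod (mob a z))\<^sup>2" by simp
    moreover have "0 < C\<^sup>2" using C2 by linarith
    ultimately have "1 \<le> C\<^sup>2 * (cmod (mob a z))\<^sup>2" by (simp add: pos_divide_le_eq mult.commute)
    then have "1\<^sup>2 \<le> (C * cmod (mob a z))\<^sup>2" by (simp add: power_mult_distrib)
    then show "1 \<le> C * cmod (mob a z)" by (rule power2_le_imp_le) (use C in simp)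
  qed
qed

text \<open>Near the circle the quotient is dominated by \<open>C\<close> times \<open>ev u\<close>
  for every \<open>C > 1\<close>; letting \<open>C\<close> tend to 1 shows that removing a zero does
  not increase the norm.\<close>

lemma divide_bfactor:
  assumes a: "cmod a < 1" and u: "ev u a = 0"
  obtains w where "\<And>z. cmod z < 1 \<Longrightarrow> ev u z = bfactor a z * ev w z" "norm w \<le> norm u"
proof -
  obtain c where c: "cmod c = 1" "\<And>z. bfactor a z = c * mob a z" using bfactor_eq_mob by blast
  \<comment> \<open>The derivative fills the removable singularity at \<open>a\<close>; the cofactor
    in \<open>q\<close> then cancels the constant and the denominator of
    \<open>bfactor a\<close>.\<close>
  define p where "p z = (if z = a then deriv (ev u) a else (ev u z - ev u a) / (z - a))" for z
  define q where "q z = p z * (- (1 - cnj a * z) / c)" for z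
  have "p holomorphic_on ball 0 1"
    unfolding p_def using pole_lemma_open[OF holomorphic_ev open_ball] by blast
  then have hol: "q holomorphic_on ball 0 1"
    unfolding q_def using c(1) by (intro holomorphic_intros) auto
  have eq: "ev u z = bfactor a z * q z" if z: "cmod z < 1" for z
  proof (cases "z = a")
    case True
    then show ?thesis using u by (simp add: c(2) mob_def)
  next
    case False
    have "c \<noteq> 0" using c(1) by auto
    have "1 - cnj a * z \<noteq> 0" using one_minus_cnj_mult_nonzero[OF a] z by simp
    then have "bfactor a z * q z = (a - z) * (- p z)"
      using \<open>c \<noteq> 0\<close> unfolding c(2) q_def mob_def by (simp add: divide_simps) (simp add: algebra_simps)
    also have "\<dots> = ev u z" using False u by (simp add: p_def divide_simps) (simp add: algebra_simps)
    finally show ?thesis by simp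
  qed
  have dom: "q \<in> H2 \<and> norm (taylor q) \<le> C * norm u" if C: "1 < C" for C
  proof -
    obtain R where R: "R < 1" "\<And>z. R < cmod z \<Longrightarrow> cmod z < 1 \<Longrightarrow> 1 \<le> C * cmod (mob a z)"
      using cmod_mob_lower_bound[OF a C] by blast
    have "cmod (q z) \<le> C * cmod (ev u z)" if "R < cmod z" "cmod z < 1" for z
    proof -
      have "1 * cmod (q z) \<le> (C * cmod (mob a z)) * cmod (q z)"
        using R(2)[OF that] by (rule mult_right_mono) simp
      then show ?thesis using eq[OF that(2)] by (simp add: norm_mult cmod_bfactor)
    qed
    then show ?thesis using H2_dominated[OF hol ev_in_H2[of u] R(1), of C] C by simp
  qed
  have "norm (taylor q) \<le> norm u"
  proof (rule field_le_epsilon)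
    fix e :: real assume e: "0 < e"
    \<comment> \<open>The summand 1 in the denominator covers \<open>norm u = 0\<close> and still
      gives \<open>(C - 1) * norm u \<le> e\<close>.\<close>
    define C where "C = 1 + e / (norm u + 1)"
    have "norm (taylor q) \<le> C * norm u" using dom[of C] e by (simp add: C_def add_nonneg_pos)
    also have "\<dots> = norm u + e * (norm u / (norm u + 1))"
      by (simp add: C_def algebra_simps)
    also have "\<dots> \<le> norm u + e" proof -
      have "norm u / (norm u + 1) \<le> 1" by (subst pos_divide_le_eq) (auto simp: add_nonneg_pos)
      then have "e * (norm u / (norm u + 1)) \<le> e * 1" using e by (intro mult_left_mono) auto
      then show ?thesis by simp
    qed
    finally show "norm (taylor q) \<le> norm u + e" .
  qed
  then show ?thesis
    using dom[of 2] eq by (intro that[of "taylor q"]) (simp_all add: ev_taylor)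
qed

text \<open>As the zeros are distinct, the factors already removed do not vanish at
  \<open>lam N\<close>, so the quotient does. The norm bound is uniform in \<open>N\<close>, which
  is what the passage to the infinite product needs.\<close>

lemma divide_finite_blaschke:
  fixes lam :: "nat \<Rightarrow> complex"
  assumes lam: "\<And>n. cmod (lam n) < 1" and inj: "inj lam" and u: "\<And>n. ev u (lam n) = 0"
  shows "\<exists>w. (\<forall>z. cmod z < 1 \<longrightarrow> ev u z = (\<Prod>k<N. bfactor (lam k) z) * ev w z) \<and> norm w \<le> norm u"
proof (induction N)
  case 0
  show ?case by (intro exI[of _ u]) simp
next
  case (Suc N)
  then obtain w where w: "\<And>z. cmod z < 1 \<Longrightarrow> ev u z = (\<Prod>k<N. bfactor (lam k) z) * ev w z"
    "norm w \<le> norm u" by blast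
  have "(\<Prod>k<N. bfactor (lam k) (lam N)) \<noteq> 0"
    using inj by (auto simp: bfactor_eq_0_iff lam dest: injD)
  then have "ev w (lam N) = 0" using w(1)[OF lam, of N] u[of N] by simp
  then obtain w' where "\<And>z. cmod z < 1 \<Longrightarrow> ev w z = bfactor (lam N) z * ev w' z" "norm w' \<le> norm w"
    using divide_bfactor[OF lam] by blast
  then show ?case using w by (intro exI[of _ w']) (auto simp: mult_ac)
qed

section \<open>Compactness of norm-bounded sets under pointwise convergence\<close>

lemma norm_ker_bounded_on_compact:
  assumes "compact K" "K \<subseteq> ball 0 1"
  shows "\<exists>B\<ge>0. \<forall>z\<in>K. norm (ker z) \<le> B"
proof -
  have "continuous_on K (\<lambda>z. sqrt (1 / (1 - (cmod z)\<^sup>2)))"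
    by (intro continuous_intros) (use assms(2) in \<open>auto simp: abs_square_eq_1\<close>)
  then have "bounded ((\<lambda>z. sqrt (1 / (1 - (cmod z)\<^sup>2))) ` K)"
    using assms(1) compact_continuous_image compact_imp_bounded by blast
  then obtain B where B: "B > 0" "\<And>z. z \<in> K \<Longrightarrow> \<bar>sqrt (1 / (1 - (cmod z)\<^sup>2))\<bar> \<le> B"
    unfolding bounded_pos by auto
  have "norm (ker z) \<le> B" if "z \<in> K" for z
  proof -
    have z: "cmod z < 1" using assms(2) that by auto
    have "norm (ker z) = sqrt (1 / (1 - (cmod z)\<^sup>2))"
      by (rule real_sqrt_unique[symmetric]) (simp_all add: norm_ker[OF z])
    then show ?thesis using B(2)[OF that] by simp
  qed
  then show ?thesis using B(1) by (intro exI[of _ B]) auto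
qed

text \<open>This replaces weak compactness of balls: evaluation bounds allow Montel's theorem,
  locally uniform convergence carries over to Taylor coefficients, and the common norm bound makes
  the limit square summable.\<close>

lemma bounded_l2_pointwise_limit:
  fixes w :: "nat \<Rightarrow> l2"
  assumes bd: "\<And>n. norm (w n) \<le> C"
  shows "\<exists>v r. strict_mono r \<and> (\<forall>z. cmod z < 1 \<longrightarrow> (\<lambda>n. ev (w (r n)) z) \<longlonglongrightarrow> ev v z)"
proof -
  have C0: "0 \<le> C" using bd[of 0] norm_ge_zero order_trans by blast
  define H where "H = {ev v | v. norm v \<le> C}"
  have bdd: "\<exists>B. \<forall>h\<in>H. \<forall>z\<in>K. norm (h z) \<le> B" if K: "compact K" "K \<subseteq> ball 0 1" for K
  proof -
    obtain B where B: "B \<ge> 0" "\<And>z. z \<in> K \<Longrightarrow> norm (ker z) \<le> B"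
      using norm_ker_bounded_on_compact[OF K] by blast
    have "cmod (ev v z) \<le> C * B" if "norm v \<le> C" "z \<in> K" for v z
    proof -
      have "cmod (ev v z) \<le> norm v * norm (ker z)" using cmod_ev_le[of z v] K(2) that(2) by auto
      also have "\<dots> \<le> C * B" using that B C0 by (intro mult_mono) auto
      finally show ?thesis .
    qed
    then show ?thesis by (auto simp: H_def)
  qed
  have hol: "h holomorphic_on ball 0 1" if "h \<in> H" for h
    using that holomorphic_ev by (auto simp: H_def)
  have rng: "range (\<lambda>n. ev (w n)) \<subseteq> H" using bd by (auto simp: H_def)
  show ?thesis
  proof (rule Montel[OF open_ball hol bdd rng])
    fix g and r :: "nat \<Rightarrow> nat"
    assume g: "g holomorphic_on ball 0 1" "strict_mono r"
      "\<And>z. z \<in> ball 0 1 \<Longrightarrow> (\<lambda>n. ev (w (r n)) z) \<longlonglongrightarrow> g z"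
      "\<And>K. compact K \<Longrightarrow> K \<subseteq> ball 0 1 \<Longrightarrow> uniform_limit K ((\<lambda>n. ev (w n)) \<circ> r) g sequentially"
    have ul: "uniform_limit (ball 0 (1/2)) (\<lambda>n. ev (w (r n))) g sequentially"
    proof (rule uniform_limit_on_subset)
      show "uniform_limit (cball 0 (1/2)) (\<lambda>n. ev (w (r n))) g sequentially"
        using g(4)[of "cball 0 (1/2)"] by (auto simp: o_def cball_subset_ball_iff)
    qed auto
    have tc: "(\<lambda>n. seq (w (r n)) k) \<longlonglongrightarrow> tcoeff g k" for k
    proof -
      have "((\<lambda>n. (deriv ^^ k) (ev (w (r n))) 0) \<longlongrightarrow> (deriv ^^ k) g 0) sequentially"
      proof (rule higher_deriv_complex_uniform_limit[OF ul])
        have "ev v holomorphic_on ball 0 (1/2)" for v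
          by (rule holomorphic_on_subset[OF holomorphic_ev]) auto
        then show "\<forall>\<^sub>F n in sequentially. ev (w (r n)) holomorphic_on ball 0 (1/2)" by simp
      qed auto
      then have "(\<lambda>n. tcoeff (ev (w (r n))) k) \<longlonglongrightarrow> tcoeff g k"
        unfolding tcoeff_def by (intro tendsto_divide) auto
      then show ?thesis
        by (simp flip: seq_taylor[OF ev_in_H2])
    qed
    have "(\<Sum>k<N. (cmod (tcoeff g k))\<^sup>2) \<le> C\<^sup>2" for N
    proof (rule LIMSEQ_le_const2)
      show "(\<lambda>n. \<Sum>k<N. (cmod (seq (w (r n)) k))\<^sup>2) \<longlonglongrightarrow> (\<Sum>k<N. (cmod (tcoeff g k))\<^sup>2)"
        by (intro tendsto_intros tc)
      have "(\<Sum>k<N. (cmod (seq (w (r n)) k))\<^sup>2) \<le> C\<^sup>2" for n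
        using sum_le_norm_l2[of "w (r n)" N] power_mono[OF bd[of "r n"] norm_ge_zero, of 2] by linarith
      then show "\<exists>M. \<forall>n\<ge>M. (\<Sum>k<N. (cmod (seq (w (r n)) k))\<^sup>2) \<le> C\<^sup>2" by blast
    qed
    then have "summable (\<lambda>k. (cmod (tcoeff g k))\<^sup>2)"
      by (intro summableI_nonneg_bounded[where x = "C\<^sup>2"]) auto
    then have "g \<in> H2" using g(1) by (simp add: H2_def)
    show ?thesis
    proof (intro exI conjI allI impI)
      show "strict_mono r" by (rule g(2))
      show "(\<lambda>n. ev (w (r n)) z) \<longlonglongrightarrow> ev (taylor g) z" if "cmod z < 1" for z
        using g(3)[of z] that by (simp add: ev_taylor[OF \<open>g \<in> H2\<close>])
    qed
  qed
qed

text \<open>The comparison function is the constant 1, which is the kernel at the origin.\<close>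

lemma norm_taylor_le_of_bounded:
  assumes "f holomorphic_on ball 0 1" "\<And>z. cmod z < 1 \<Longrightarrow> cmod (f z) \<le> 1"
  shows "f \<in> H2" "norm (taylor f) \<le> 1"
proof -
  have 1: "ev (ker 0) z = 1" if "cmod z < 1" for z using ev_ker[of 0 z] that by simp
  have n1: "norm (ker 0) = 1"
    using norm_ker[of 0] norm_ge_zero[of "ker 0"] by (simp add: power2_eq_1_iff)
  show "f \<in> H2" "norm (taylor f) \<le> 1"
    using H2_dominated[OF assms(1) ev_in_H2[of "ker 0"], of 0 1] assms(2) 1 n1 by simp_all
qed

context interpolating
begin

abbreviation I :: "complex \<Rightarrow> complex" where "I \<equiv> blaschke_prod lam"

text \<open>The infinite product is a definite description, so its value is informative only once
  convergence is known; a vanishing factor is compatible with \<open>has_prod\<close>.\<close>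

lemma partial_blaschke_tendsto:
  assumes z: "cmod z < 1"
  shows "(\<lambda>N. \<Prod>k<N. bfactor (lam k) z) \<longlonglongrightarrow> I z"
proof -
  have "summable (\<lambda>n. norm (bfactor (lam n) z - 1))"
  proof (rule summable_comparison_test'[where N = 0])
    show "summable (\<lambda>n. 2 / (1 - cmod z) * (1 - cmod (lam n)))"
      by (rule summable_mult[OF summable_lam])
    show "norm (norm (bfactor (lam n) z - 1)) \<le> 2 / (1 - cmod z) * (1 - cmod (lam n))" for n
      using cmod_bfactor_minus_1_le[OF lam z, of n] by simp
  qed
  then have "convergent_prod (\<lambda>n. bfactor (lam n) z)"
    by (rule abs_convergent_prod_imp_convergent_prod[OF summable_imp_abs_convergent_prod])
  then have "(\<lambda>n. bfactor (lam n) z) has_prod I z"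
    unfolding blaschke_prod_def by (simp add: convergent_prod_has_prod_iff)
  then show ?thesis by (rule has_prod_imp_tendsto')
qed

lemma cmod_partial_blaschke_le_1: "cmod z < 1 \<Longrightarrow> cmod (\<Prod>k<N. bfactor (lam k) z) \<le> 1"
  unfolding prod_norm[symmetric]
  by (intro prod_le_1) (auto simp: cmod_bfactor intro: cmod_mob_le_1[OF lam])

lemma cmod_blaschke_le_1: "cmod z < 1 \<Longrightarrow> cmod (I z) \<le> 1"
  using Lim_bounded[OF tendsto_norm[OF partial_blaschke_tendsto], of z 0 1] cmod_partial_blaschke_le_1[of z]
  by blast

lemma blaschke_lam: "I (lam n) = 0"
proof -
  have "\<forall>\<^sub>F N in sequentially. (\<Prod>k<N. bfactor (lam k) (lam n)) = 0"
    using eventually_gt_at_top[of n] by eventually_elim (auto simp: bfactor_eq_0_iff lam)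
  then have "(\<lambda>N. \<Prod>k<N. bfactor (lam k) (lam n)) \<longlonglongrightarrow> 0"
    by (rule tendsto_eventually)
  then show ?thesis using partial_blaschke_tendsto[OF lam, of n] LIMSEQ_unique by blast
qed

text \<open>Compactness spares a proof of locally uniform convergence: some subsequence of the
  partial products tends to a holomorphic function, which must be their pointwise limit
  \<open>I\<close>.\<close>

lemma holomorphic_blaschke: "I holomorphic_on ball 0 1"
proof -
  define P where "P N z = (\<Prod>k<N. bfactor (lam k) z)" for N z
  have hol: "P N holomorphic_on ball 0 1" for N
    unfolding P_def by (intro holomorphic_on_prod holomorphic_bfactor lam)
  have P: "P N \<in> H2" "norm (taylor (P N)) \<le> 1" for N
    using norm_taylor_le_of_bounded[OF hol, of N] cmod_partial_blaschke_le_1 by (auto simp: P_def)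
  obtain v r where v: "strict_mono (r :: nat \<Rightarrow> nat)"
    "\<And>z. cmod z < 1 \<Longrightarrow> (\<lambda>n. ev (taylor (P (r n))) z) \<longlonglongrightarrow> ev v z"
    using bounded_l2_pointwise_limit[of "\<lambda>n. taylor (P n)", OF P(2)] by blast
  have "I z = ev v z" if z: "cmod z < 1" for z
  proof -
    have "(\<lambda>n. P (r n) z) \<longlonglongrightarrow> I z"
      using LIMSEQ_subseq_LIMSEQ[OF partial_blaschke_tendsto[OF z] v(1)] by (simp add: P_def o_def)
    then show ?thesis using v(2)[OF z] LIMSEQ_unique by (simp add: ev_taylor[OF P(1) z])
  qed
  then show ?thesis using H2_eqI(1)[of I v] holomorphic_H2 by blast
qed

text \<open>The quotients by finite products stay in one ball of \<open>l2\<close>; a pointwise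
  limit of a subsequence is the quotient by \<open>I\<close>.\<close>

lemma divide_blaschke:
  assumes u: "\<And>n. ev u (lam n) = 0"
  obtains w where "\<And>z. cmod z < 1 \<Longrightarrow> ev u z = I z * ev w z"
proof -
  have "\<forall>N. \<exists>w. (\<forall>z. cmod z < 1 \<longrightarrow> ev u z = (\<Prod>k<N. bfactor (lam k) z) * ev w z) \<and> norm w \<le> norm u"
    using divide_finite_blaschke[OF lam inj_lam u] by (rule allI)
  from choice[OF this] obtain w where w: "\<And>N z. cmod z < 1 \<Longrightarrow> ev u z = (\<Prod>k<N. bfactor (lam k) z) * ev (w N) z"
    "\<And>N. norm (w N) \<le> norm u"
    by blast
  obtain v r where v: "strict_mono (r :: nat \<Rightarrow> nat)"
    "\<And>z. cmod z < 1 \<Longrightarrow> (\<lambda>n. ev (w (r n)) z) \<longlonglongrightarrow> ev v z"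
    using bounded_l2_pointwise_limit[of w, OF w(2)] by blast
  have "ev u z = I z * ev v z" if z: "cmod z < 1" for z
  proof -
    have "(\<lambda>n. (\<Prod>k<r n. bfactor (lam k) z) * ev (w (r n)) z) \<longlonglongrightarrow> I z * ev v z"
      using LIMSEQ_subseq_LIMSEQ[OF partial_blaschke_tendsto[OF z] v(1)] v(2)[OF z]
      by (intro tendsto_mult) (simp_all add: o_def)
    then show ?thesis
      by (simp only: w(1)[OF z, symmetric] LIMSEQ_const_iff)
  qed
  then show ?thesis by (rule that)
qed

end

section \<open>Kernel combinations in the model space\<close>

text \<open>\<open>V\<close> need not be closed, so the nearest point is sought in its closure, as
  the limit of a minimizing sequence.\<close>

lemma orthogonal_projection:
  fixes V :: "'a::{real_inner, banach} set"
  assumes V: "subspace V"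
  shows "\<exists>v. v \<in> closure V \<and> (\<forall>w\<in>V. inner (u - v) w = 0)"
proof -
  define d where "d = infdist u V"
  have ne: "V \<noteq> {}" using subspace_0[OF V] by blast
  have d0: "0 \<le> d" by (simp add: d_def infdist_nonneg)
  have dle: "d \<le> norm (u - w)" if "w \<in> V" for w
    unfolding d_def dist_norm[symmetric] using that by (rule infdist_le)
  define E where "E m = d + inverse (real (Suc m))" for m
  have "\<exists>w\<in>V. norm (u - w) < E m" for m
  proof (rule ccontr)
    assume "\<not> ?thesis"
    then have "E m \<le> d"
      unfolding d_def infdist_notempty[OF ne] dist_norm using ne by (intro cINF_greatest) (auto simp: not_less)
    then show False by (simp add: E_def)
  qed
  then have "\<forall>m. \<exists>w. w \<in> V \<and> norm (u - w) < E m" by blast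
  from choice[OF this] obtain v where v: "\<And>m. v m \<in> V" "\<And>m. norm (u - v m) < E m" by blast
  have Elim: "E \<longlonglongrightarrow> d"
    unfolding E_def using tendsto_add[OF tendsto_const LIMSEQ_inverse_real_of_nat, of d] by simp
  have E2: "(\<lambda>m. (E m)\<^sup>2 - d\<^sup>2) \<longlonglongrightarrow> 0"
    using tendsto_diff[OF tendsto_power[OF Elim, of 2] tendsto_const[of "d\<^sup>2"]] by simp
  \<comment> \<open>The midpoint of \<open>v m\<close> and \<open>v k\<close> lies in
    \<open>V\<close>, hence at distance at least \<open>d\<close> from \<open>u\<close>; the
    parallelogram law turns this into closeness of the two points.\<close>
  have par: "(norm (v m - v k))\<^sup>2 \<le> 2 * ((E m)\<^sup>2 - d\<^sup>2) + 2 * ((E k)\<^sup>2 - d\<^sup>2)" for m k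
  proof -
    have "(norm (v m - v k))\<^sup>2 = 2 * (norm (u - v m))\<^sup>2 + 2 * (norm (u - v k))\<^sup>2
        - (norm ((u - v m) + (u - v k)))\<^sup>2"
      by (simp add: power2_norm_eq_inner inner_add_left inner_add_right inner_diff_left inner_diff_right inner_commute)
    also have "(u - v m) + (u - v k) = 2 *\<^sub>R (u - (1/2) *\<^sub>R (v m + v k))"
      by (simp add: algebra_simps scaleR_2)
    also have "(norm \<dots>)\<^sup>2 = 4 * (norm (u - (1/2) *\<^sub>R (v m + v k)))\<^sup>2"
      by (simp add: power_mult_distrib)
    finally have eq: "(norm (v m - v k))\<^sup>2 = 2 * (norm (u - v m))\<^sup>2 + 2 * (norm (u - v k))\<^sup>2
        - 4 * (norm (u - (1/2) *\<^sub>R (v m + v k)))\<^sup>2" .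
    have "(1/2) *\<^sub>R (v m + v k) \<in> V" using v(1) V by (simp add: subspace_add subspace_scale)
    then have "d\<^sup>2 \<le> (norm (u - (1/2) *\<^sub>R (v m + v k)))\<^sup>2" using dle d0 by (intro power_mono) auto
    moreover have "(norm (u - v j))\<^sup>2 \<le> (E j)\<^sup>2" for j using v(2)[of j] by (intro power_mono) auto
    moreover have "2 * a + 2 * b - 4 * y \<le> 2 * (A - D) + 2 * (B - D)"
      if "D \<le> y" "a \<le> A" "b \<le> B" for a b y A B D :: real
      using that by argo
    ultimately show ?thesis unfolding eq by blast
  qed
  have "Cauchy v"
    unfolding Cauchy_def dist_norm
  proof (intro allI impI)
    fix e :: real assume e: "e > 0"
    then have "0 < e\<^sup>2 / 4" by simp
    from order_tendstoD(2)[OF E2 this]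
    obtain M where M: "\<And>m. m \<ge> M \<Longrightarrow> (E m)\<^sup>2 - d\<^sup>2 < e\<^sup>2 / 4"
      unfolding eventually_sequentially by blast
    have "norm (v m - v k) < e" if "m \<ge> M" "k \<ge> M" for m k
    proof -
      have "y < q" if "y \<le> 2 * a + 2 * b" "a < q / 4" "b < q / 4" for y a b q :: real
        using that by argo
      then have "(norm (v m - v k))\<^sup>2 < e\<^sup>2" using par[of m k] M[OF that(1)] M[OF that(2)] by blast
      then show ?thesis using e by (rule power2_less_imp_less[OF _ less_imp_le])
    qed
    then show "\<exists>M. \<forall>m\<ge>M. \<forall>n\<ge>M. norm (v m - v n) < e" by blast
  qed
  then obtain v' where lim: "v \<longlonglongrightarrow> v'" using Cauchy_convergent convergent_def by metis
  define f where "f = u - v'"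
  have "norm f \<le> d"
  proof (rule LIMSEQ_le)
    show "(\<lambda>m. norm (u - v m)) \<longlonglongrightarrow> norm f" unfolding f_def by (intro tendsto_intros lim)
    show "\<exists>N. \<forall>n\<ge>N. norm (u - v n) \<le> E n" using v(2) less_imp_le by blast
  qed (rule Elim)
  have far: "d \<le> norm (f - t *\<^sub>R w)" if "w \<in> V" for t w
  proof (rule LIMSEQ_le_const)
    show "(\<lambda>m. norm (u - v m - t *\<^sub>R w)) \<longlonglongrightarrow> norm (f - t *\<^sub>R w)"
      unfolding f_def by (intro tendsto_intros lim)
    have "d \<le> norm (u - v m - t *\<^sub>R w)" for m
      using dle[of "v m + t *\<^sub>R w"] V v(1) that by (simp add: subspace_add subspace_scale diff_diff_add)
    then show "\<exists>N. \<forall>n\<ge>N. d \<le> norm (u - v n - t *\<^sub>R w)" by blast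
  qed
  have "inner f w = 0" if w: "w \<in> V" for w
  proof (cases "w = 0")
    case False
    \<comment> \<open>This \<open>t\<close> minimizes the distance from \<open>f\<close> to the
      multiples of \<open>w\<close>; a nonzero inner product would push it below
      \<open>d\<close>.\<close>
    define t where "t = inner f w / (norm w)\<^sup>2"
    have n0: "0 < (norm w)\<^sup>2" using False by simp
    have "(norm f)\<^sup>2 \<le> (norm (f - t *\<^sub>R w))\<^sup>2"
      using \<open>norm f \<le> d\<close> far[OF w, of t] by (intro power_mono) auto
    also have "\<dots> = (norm f)\<^sup>2 - 2 * t * inner f w + t * (t * (norm w)\<^sup>2)"
      by (simp add: power2_norm_eq_inner inner_diff_left inner_diff_right inner_commute algebra_simps)
    also have "t * (norm w)\<^sup>2 = inner f w" using n0 by (simp add: t_def)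
    finally have "t * inner f w \<le> 0" by simp
    then have "(inner f w)\<^sup>2 \<le> 0"
      using n0 by (simp add: t_def power2_eq_square divide_le_0_iff)
    then show ?thesis by simp
  qed simp
  moreover have "v' \<in> closure V" using v(1) lim closure_sequential by blast
  ultimately show ?thesis unfolding f_def by blast
qed

lemma tcoeff_ev [simp]: "tcoeff (ev u) = seq u"
  using seq_taylor[OF ev_in_H2[of u]] by simp

lemma cinner_diff_left: "cinner (u - v) w = cinner u w - cinner v w"
  by (metis cinner_add_left add_diff_cancel_right' diff_add_cancel)

lemma tendsto_cinner:
  assumes "u \<longlonglongrightarrow> v"
  shows "(\<lambda>n. cinner (u n) w) \<longlonglongrightarrow> cinner v w"
proof -
  have "(\<lambda>n. norm (u n - v) * norm w) \<longlonglongrightarrow> 0"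
    using tendsto_mult_left_zero[OF tendsto_norm_zero[OF LIM_zero[OF assms]]] .
  then have "(\<lambda>n. cinner (u n) w - cinner v w) \<longlonglongrightarrow> 0"
    by (rule Lim_null_comparison[rotated]) (simp add: cmod_cinner_le flip: cinner_diff_left)
  then show ?thesis by (rule LIM_zero_cancel)
qed

lemma tendsto_ev: "u \<longlonglongrightarrow> v \<Longrightarrow> cmod z < 1 \<Longrightarrow> (\<lambda>n. ev (u n) z) \<longlonglongrightarrow> ev v z"
  using tendsto_cinner[of u v "ker z"] by (simp add: cinner_ker)

context interpolating
begin

lemma blaschke_mult_H2: "g \<in> H2 \<Longrightarrow> (\<lambda>z. I z * g z) \<in> H2"
proof -
  assume g: "g \<in> H2"
  have "(\<lambda>z. I z * g z) holomorphic_on ball 0 1"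
    by (intro holomorphic_intros holomorphic_blaschke holomorphic_H2 g)
  moreover have "cmod (I z * g z) \<le> 1 * cmod (g z)" if "cmod z < 1" for z
    using cmod_blaschke_le_1[OF that] unfolding norm_mult by (rule mult_right_mono) simp
  ultimately show ?thesis using H2_dominated(1)[OF _ g, of _ 0 1] by simp
qed

definition mspace :: "l2 set" where
  "mspace = {u. \<forall>g\<in>H2. cinner u (taylor (\<lambda>z. I z * g z)) = 0}"

lemma model_space_iff: "f \<in> model_space I \<longleftrightarrow> f \<in> H2 \<and> taylor f \<in> mspace"
  unfolding model_space_def mspace_def using blaschke_mult_H2 by (auto simp: h2_inner_eq)

lemma ev_in_model_space: "ev u \<in> model_space I \<longleftrightarrow> u \<in> mspace"
  by (simp add: model_space_iff ev_in_H2)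

lemma mspace_0: "0 \<in> mspace"
  by (simp add: mspace_def cinner_def)

lemma mspace_add: "u \<in> mspace \<Longrightarrow> v \<in> mspace \<Longrightarrow> u + v \<in> mspace"
  by (simp add: mspace_def cinner_add_left)

lemma mspace_diff: "u \<in> mspace \<Longrightarrow> v \<in> mspace \<Longrightarrow> u - v \<in> mspace"
  by (simp add: mspace_def cinner_diff_left)

lemma mspace_cscale: "u \<in> mspace \<Longrightarrow> cscale c u \<in> mspace"
  by (simp add: mspace_def cinner_cscale_left)

lemma mspace_limit:
  assumes "\<And>n. u n \<in> mspace" "u \<longlonglongrightarrow> v"
  shows "v \<in> mspace"
  unfolding mspace_def
proof (intro CollectI ballI)
  fix g assume "g \<in> H2"
  then have "(\<lambda>n. cinner (u n) (taylor (\<lambda>z. I z * g z))) = (\<lambda>_. 0)"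
    using assms(1) by (auto simp: mspace_def)
  then show "cinner v (taylor (\<lambda>z. I z * g z)) = 0"
    using tendsto_cinner[OF assms(2), of "taylor (\<lambda>z. I z * g z)"] by (simp add: LIMSEQ_const_iff)
qed

lemma ker_in_mspace: "ker (lam n) \<in> mspace"
  unfolding mspace_def
proof (intro CollectI ballI)
  fix g assume g: "g \<in> H2"
  have "cinner (taylor (\<lambda>z. I z * g z)) (ker (lam n)) = 0"
    by (simp add: cinner_ker lam ev_taylor[OF blaschke_mult_H2[OF g]] blaschke_lam)
  then show "cinner (ker (lam n)) (taylor (\<lambda>z. I z * g z)) = 0"
    by (subst cinner_commute) simp
qed

text \<open>Divisibility by \<open>I\<close> makes \<open>u\<close> one of the vectors to which
  members of \<open>mspace\<close> are orthogonal, so \<open>u\<close> is orthogonal to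
  itself.\<close>

lemma mspace_eq_0I:
  assumes u: "u \<in> mspace" and z: "\<And>n. ev u (lam n) = 0"
  shows "u = 0"
proof -
  obtain w where w: "\<And>z. cmod z < 1 \<Longrightarrow> I z * ev w z = ev u z"
    using divide_blaschke[OF z] by metis
  then have "taylor (\<lambda>z. I z * ev w z) = u" by (rule H2_eqI(2))
  then have "cinner u u = 0" using u ev_in_H2[of w] by (auto simp: mspace_def)
  then have "inner u u = 0" by (simp flip: Re_cinner)
  then show ?thesis by simp
qed

section \<open>Finite kernel combinations, their density and the diagonal action\<close>

definition s :: "nat \<Rightarrow> real" where "s n = sqrt (1 - (cmod (lam n))\<^sup>2)"

lemma s_pos: "0 < s n"
  using lam[of n] by (simp add: s_def abs_square_less_1)

lemma x_eq: "x n = cscale (of_real (s n)) (ker (lam n))"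
  by (simp add: unit_ker_def s_def)

definition comb :: "nat \<Rightarrow> (nat \<Rightarrow> complex) \<Rightarrow> l2" where
  "comb N c = (\<Sum>n<N. cscale (c n) (x n))"

lemma comb_in_mspace: "comb N c \<in> mspace"
  unfolding comb_def
  by (induction N) (auto intro: mspace_0 mspace_add mspace_cscale ker_in_mspace simp: x_eq simp del: cscale_cscale)

lemma comb_mono:
  assumes "N \<le> K"
  shows "comb N c = comb K (\<lambda>n. if n < N then c n else 0)"
  unfolding comb_def using assms by (intro sum.mono_neutral_cong_left) auto

lemma comb_diff_same: "comb N b - comb N c = comb N (\<lambda>n. b n - c n)"
  by (simp add: comb_def cscale_diff sum_subtractf)

lemma comb_add_same: "comb N b + comb N c = comb N (\<lambda>n. b n + c n)"
  by (simp add: comb_def cscale_add sum.distrib)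

lemma cscale_comb: "cscale a (comb N c) = comb N (\<lambda>n. a * c n)"
  by (simp add: comb_def cscale_sum)

lemma subspace_combs: "subspace {comb N c | N c. True}"
  unfolding subspace_def
proof (intro conjI ballI allI)
  show "0 \<in> {comb N c | N c. True}"
    by (rule CollectI, rule exI[of _ 0]) (simp add: comb_def)
next
  fix u v assume "u \<in> {comb N c | N c. True}" "v \<in> {comb N c | N c. True}"
  then obtain N c N' c' where "u = comb N c" "v = comb N' c'" by blast
  then have "u + v = comb (max N N') (\<lambda>n. (if n < N then c n else 0) + (if n < N' then c' n else 0))"
    using comb_mono[of N "max N N'" c] comb_mono[of N' "max N N'" c'] by (simp add: comb_add_same)
  then show "u + v \<in> {comb N c | N c. True}" by blast
next
  fix r u assume "u \<in> {comb N c | N c. True}"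
  then obtain N c where "u = comb N c" by blast
  then have "r *\<^sub>R u = comb N (\<lambda>n. of_real r * c n)"
    by (simp add: scaleR_conv_cscale cscale_comb)
  then show "r *\<^sub>R u \<in> {comb N c | N c. True}" by blast
qed

lemma combs_dense:
  assumes u: "u \<in> mspace"
  obtains N c where "(\<lambda>m. comb (N m) (c m)) \<longlonglongrightarrow> u"
proof -
  obtain v where v: "v \<in> closure {comb N c | N c. True}"
    and orth: "\<And>w. w \<in> {comb N c | N c. True} \<Longrightarrow> inner (u - v) w = 0"
    using orthogonal_projection[OF subspace_combs, of u] by blast
  obtain p where p: "\<And>m. p m \<in> {comb N c | N c. True}" "p \<longlonglongrightarrow> v"
    using v unfolding closure_sequential by blast
  then have "\<forall>m. \<exists>N c. p m = comb N c" by blast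
  then obtain N c where Nc: "\<And>m. p m = comb (N m) (c m)" by metis
  have "v \<in> mspace"
    by (rule mspace_limit[OF _ p(2)]) (simp add: Nc comb_in_mspace)
  then have uv: "u - v \<in> mspace" using u by (rule mspace_diff[rotated])
  have "ev (u - v) (lam n) = 0" for n
  proof -
    \<comment> \<open>The projection gives orthogonality for the real inner product only; the
      multiples \<open>1\<close> and \<open>\<i>\<close> of the kernel recover real and imaginary
      parts of the value.\<close>
    have k: "inner (u - v) (cscale a (ker (lam n))) = 0" for a
    proof (rule orth)
      have "cscale a (ker (lam n)) = cscale (a / of_real (s n)) (x n)"
        using s_pos[of n] by (simp add: x_eq)
      also have "\<dots> = comb (Suc n) (\<lambda>k. if k = n then a / of_real (s n) else 0)"
        by (simp add: comb_def)
      finally show "cscale a (ker (lam n)) \<in> {comb N c | N c. True}" by blast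
    qed
    have "Re (ev (u - v) (lam n)) = 0" using k[of 1] by (simp add: inner_cscale_ker[OF lam] del: cscale_one)
    moreover have "Im (ev (u - v) (lam n)) = 0" using k[of \<i>] by (simp add: inner_cscale_ker[OF lam])
    ultimately show ?thesis by (simp add: complex_eq_iff)
  qed
  then have "u = v" using mspace_eq_0I[OF uv] by simp
  moreover have "p = (\<lambda>m. comb (N m) (c m))" using Nc by auto
  ultimately show ?thesis using p(2) that[of N c] by simp
qed

text \<open>The closed form of \<open>ev (comb N c)\<close>, which, unlike the power series, is
  available at \<zeta> on the circle as well.\<close>

definition rat :: "nat \<Rightarrow> (nat \<Rightarrow> complex) \<Rightarrow> complex \<Rightarrow> complex" where
  "rat N c z = (\<Sum>n<N. c n * of_real (s n) / (1 - cnj (lam n) * z))"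

lemma ev_comb:
  assumes "cmod z < 1"
  shows "ev (comb N c) z = rat N c z"
  using assms by (simp add: comb_def rat_def ev_sum ev_cscale x_eq ev_ker lam del: cscale_cscale)

text \<open>Required because \<open>tto_graph\<close> admits only bounded functions as
  arguments.\<close>

lemma bounded_comb: "bounded_on_disk (ev (comb N c))"
  unfolding bounded_on_disk_def
proof (rule boundedI)
  fix y assume "y \<in> ev (comb N c) ` ball 0 1"
  then obtain z where z: "cmod z < 1" "y = ev (comb N c) z" by auto
  have "cmod (c n * of_real (s n) / (1 - cnj (lam n) * z)) \<le> cmod (c n) * s n / (1 - cmod (lam n))" for n
    unfolding norm_divide norm_mult norm_of_real
    using one_minus_cmod_le(1)[of "lam n" z] lam[of n] z(1) s_pos[of n]
    by (intro frac_le) auto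
  then show "norm y \<le> (\<Sum>n<N. cmod (c n) * s n / (1 - cmod (lam n)))"
    unfolding z(2) ev_comb[OF z(1)] rat_def by (intro order_trans[OF norm_sum] sum_mono)
qed

text \<open>Kernel coefficients are geometric, so the shift by \<open>n\<close> factors out and the
  remaining sum is the conjugate of the Taylor series of \<open>h\<close> at \<open>lam k\<close>.
  The diagonal image thus appears already at the level of coefficients, with no projection to
  compute.\<close>

lemma conjmult_coeff_comb:
  assumes h: "h \<in> H2"
  shows "conjmult_coeff h (ev (comb N c)) n = seq (comb N (\<lambda>k. c k * cnj (h (lam k)))) n"
proof -
  have "(\<lambda>j. cnj (lam k) ^ j * cnj (tcoeff h j)) sums cnj (h (lam k))" for k
    using tcoeff_sums[OF holomorphic_H2[OF h] lam, of k]
    by (subst sums_cnj[symmetric]) (simp add: mult.commute)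
  then have "(\<lambda>j. \<Sum>k<N. (c k * of_real (s k) * cnj (lam k) ^ n) * (cnj (lam k) ^ j * cnj (tcoeff h j)))
      sums (\<Sum>k<N. (c k * of_real (s k) * cnj (lam k) ^ n) * cnj (h (lam k)))"
    by (intro sums_sum sums_mult)
  moreover have "(\<lambda>j. seq (comb N c) (n + j) * cnj (tcoeff h j))
      = (\<lambda>j. \<Sum>k<N. (c k * of_real (s k) * cnj (lam k) ^ n) * (cnj (lam k) ^ j * cnj (tcoeff h j)))"
    by (simp add: comb_def x_eq seq_ker lam power_add sum_distrib_right sum_distrib_left mult_ac)
  moreover have "seq (comb N (\<lambda>k. c k * cnj (h (lam k)))) n = (\<Sum>k<N. (c k * of_real (s k) * cnj (lam k) ^ n) * cnj (h (lam k)))"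
    by (simp add: comb_def x_eq seq_ker lam mult_ac)
  ultimately show ?thesis
    by (simp only: conjmult_coeff_def tcoeff_ev sums_iff)
qed

lemma tto_graph_comb:
  assumes h: "h \<in> H2"
  shows "tto_graph I h (ev (comb N c)) (ev (comb N (\<lambda>k. c k * cnj (h (lam k)))))"
  unfolding tto_graph_def h2_inner_def
  by (simp add: ev_in_model_space comb_in_mspace bounded_comb conjmult_coeff_comb[OF h])

end

section \<open>The range of the truncated Toeplitz operator\<close>

definition bshift :: "nat \<Rightarrow> l2 \<Rightarrow> l2" where
  "bshift i u = Abs_l2 (\<lambda>j. seq u (i + j))"

lemma seq_bshift [simp]: "seq (bshift i u) j = seq u (i + j)"
proof -
  have "summable (\<lambda>j. (cmod (seq u (i + j)))\<^sup>2)"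
    using summable_iff_shift[of "\<lambda>j. (cmod (seq u j))\<^sup>2" i] summable_seq[of u] by (simp add: add.commute)
  then show ?thesis by (simp add: bshift_def seq_Abs_l2)
qed

lemma norm_bshift_le: "norm (bshift i u) \<le> norm u"
proof (rule power2_le_imp_le)
  have "(norm (bshift i u))\<^sup>2 = (norm u)\<^sup>2 - (\<Sum>k<i. (cmod (seq u k))\<^sup>2)"
    using norm_l2_sums[of "bshift i u"] sums_split_initial_segment[OF norm_l2_sums[of u], of i]
    by (intro sums_unique2) (auto simp: add.commute)
  also have "\<dots> \<le> (norm u)\<^sup>2" by (simp add: sum_nonneg)
  finally show "(norm (bshift i u))\<^sup>2 \<le> (norm u)\<^sup>2" .
qed simp

lemma bshift_diff: "bshift i (u - v) = bshift i u - bshift i v"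
  by (rule l2_eqI) simp

lemma conjmult_coeff_eq:
  assumes "h \<in> H2" "f \<in> H2"
  shows "conjmult_coeff h f i = cinner (bshift i (taylor f)) (taylor h)"
  by (simp add: conjmult_coeff_def cinner_def seq_taylor assms)

text \<open>For \<open>w = taylor h\<close> and \<open>u = taylor f\<close> this is the value at
  \<open>a\<close> of the analytic part of conj(h) f. It makes sense for every \<open>u\<close>,
  bounded or not, and depends continuously on it.\<close>

definition sample :: "l2 \<Rightarrow> complex \<Rightarrow> l2 \<Rightarrow> complex" where
  "sample w a u = (\<Sum>i. cinner (bshift i u) w * a ^ i)"

lemma sample_terms:
  "cmod (cinner (bshift i u) w * a ^ i) \<le> (norm u * norm w) * cmod a ^ i"
proof -
  have "cmod (cinner (bshift i u) w) \<le> norm (bshift i u) * norm w" by (rule cmod_cinner_le)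
  also have "\<dots> \<le> norm u * norm w" by (intro mult_right_mono norm_bshift_le) simp
  finally show ?thesis by (simp add: norm_mult norm_power mult_right_mono)
qed

lemma summable_sample:
  assumes "cmod a < 1"
  shows "summable (\<lambda>i. cinner (bshift i u) w * a ^ i)"
  by (rule summable_comparison_test'[where N = 0 and g = "\<lambda>i. (norm u * norm w) * cmod a ^ i"])
    (use assms sample_terms in \<open>auto intro!: summable_mult summable_geometric\<close>)

lemma cmod_sample_le:
  assumes "cmod a < 1"
  shows "cmod (sample w a u) \<le> norm u * (norm w / (1 - cmod a))"
proof -
  have g: "(\<lambda>i. (norm u * norm w) * cmod a ^ i) sums ((norm u * norm w) * (1 / (1 - cmod a)))"
    by (intro sums_mult geometric_sums) (use assms in simp)
  have n: "summable (\<lambda>i. cmod (cinner (bshift i u) w * a ^ i))"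
    by (rule summable_comparison_test'[where N = 0, OF sums_summable[OF g]]) (use sample_terms in simp)
  have "cmod (sample w a u) \<le> (\<Sum>i. cmod (cinner (bshift i u) w * a ^ i))"
    unfolding sample_def by (rule summable_norm[OF n])
  also have "\<dots> \<le> (\<Sum>i. (norm u * norm w) * cmod a ^ i)"
    by (rule suminf_le[OF sample_terms n sums_summable[OF g]])
  also have "\<dots> = norm u * (norm w / (1 - cmod a))"
    using sums_unique[OF g] by simp
  finally show ?thesis .
qed

lemma sample_diff:
  assumes "cmod a < 1"
  shows "sample w a (u - v) = sample w a u - sample w a v"
  unfolding sample_def suminf_diff[OF summable_sample[OF assms] summable_sample[OF assms]]
  by (simp add: bshift_diff cinner_diff_left left_diff_distrib)

lemma tendsto_sample:
  assumes "u \<longlonglongrightarrow> v" "cmod a < 1"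
  shows "(\<lambda>n. sample w a (u n)) \<longlonglongrightarrow> sample w a v"
proof -
  have "(\<lambda>n. norm (u n - v) * (norm w / (1 - cmod a))) \<longlonglongrightarrow> 0"
    using tendsto_mult_left_zero[OF tendsto_norm_zero[OF LIM_zero[OF assms(1)]]] .
  then have "(\<lambda>n. sample w a (u n) - sample w a v) \<longlonglongrightarrow> 0"
    by (rule Lim_null_comparison[rotated]) (use cmod_sample_le[OF assms(2)] in \<open>simp flip: sample_diff[OF assms(2)]\<close>)
  then show ?thesis by (rule LIM_zero_cancel)
qed

lemma Cauchy_of_norm_diff_le:
  fixes p :: "nat \<Rightarrow> 'a::real_normed_vector" and q :: "nat \<Rightarrow> 'b::real_normed_vector"
  assumes "Cauchy p" "\<And>m k. norm (q m - q k) \<le> C * norm (p m - p k)"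
  shows "Cauchy q"
  unfolding Cauchy_def dist_norm
proof (intro allI impI)
  fix e :: real assume e: "e > 0"
  \<comment> \<open>The constant \<open>C\<close> may be zero or negative; \<open>C'\<close> is
    positive and can be divided by.\<close>
  define C' where "C' = \<bar>C\<bar> + 1"
  have C': "0 < C'" by (simp add: C'_def)
  obtain M where M: "\<And>m k. m \<ge> M \<Longrightarrow> k \<ge> M \<Longrightarrow> norm (p m - p k) < e / C'"
    using assms(1) e C' unfolding Cauchy_def dist_norm by (metis divide_pos_pos)
  have "norm (q m - q k) < e" if "m \<ge> M" "k \<ge> M" for m k
  proof -
    have "norm (q m - q k) \<le> C' * norm (p m - p k)"
      by (rule order_trans[OF assms(2)]) (intro mult_right_mono, auto simp: C'_def)
    also have "\<dots> < e" using M[OF that] C' by (simp add: pos_less_divide_eq mult.commute)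
    finally show ?thesis .
  qed
  then show "\<exists>M. \<forall>m\<ge>M. \<forall>n\<ge>M. norm (q m - q n) < e" by blast
qed

text \<open>Landau's theorem, proved with the test sequence of Abel and Dini.\<close>

lemma square_summable_of_products:
  fixes b :: "nat \<Rightarrow> real"
  assumes b: "\<And>n. 0 \<le> b n"
    and prod: "\<And>a. (\<And>n. 0 \<le> a n) \<Longrightarrow> summable (\<lambda>n. (a n)\<^sup>2) \<Longrightarrow> summable (\<lambda>n. a n * b n)"
  shows "summable (\<lambda>n. (b n)\<^sup>2)"
proof -
  define S where "S n = 1 + (\<Sum>k<n. (b k)\<^sup>2)" for n
  have S1: "1 \<le> S n" for n by (simp add: S_def sum_nonneg)
  have SSuc: "S (Suc n) = S n + (b n)\<^sup>2" for n by (simp add: S_def)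
  \<comment> \<open>Dividing by the partial sum that already contains the \<open>n\<close>-th term
    bounds the square of \<open>a n\<close> by \<open>1 / S n - 1 / S (Suc n)\<close>, which
    telescopes.\<close>
  define a where "a n = b n / S (Suc n)" for n
  have a0: "0 \<le> a n" for n using b S1[of "Suc n"] by (simp add: a_def)
  have "(a n)\<^sup>2 \<le> 1 / S n - 1 / S (Suc n)" for n
  proof -
    have p: "0 < S n" "0 < S (Suc n)" using S1[of n] S1[of "Suc n"] by linarith+
    have "S n \<le> S (Suc n)" by (simp add: SSuc)
    then have "(b n)\<^sup>2 * S n \<le> (b n)\<^sup>2 * S (Suc n)" by (intro mult_left_mono) auto
    then have "(b n)\<^sup>2 / (S (Suc n) * S (Suc n)) \<le> (b n)\<^sup>2 / (S n * S (Suc n))"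
      using p by (intro divide_left_mono mult_right_mono) (auto simp: \<open>S n \<le> S (Suc n)\<close>)
    also have "\<dots> = 1 / S n - 1 / S (Suc n)"
      using p by (simp add: diff_frac_eq SSuc)
    finally show ?thesis by (simp add: a_def power_divide power2_eq_square)
  qed
  then have "(\<Sum>n<N. (a n)\<^sup>2) \<le> (\<Sum>n<N. 1 / S n - 1 / S (Suc n))" for N
    by (intro sum_mono)
  moreover have "(\<Sum>n<N. 1 / S n - 1 / S (Suc n)) \<le> 1" for N
  proof -
    have "(\<Sum>n<N. 1 / S n - 1 / S (Suc n)) = 1 / S 0 - 1 / S N"
      using sum_lessThan_telescope'[of "\<lambda>n. 1 / S n" N] by simp
    also have "\<dots> \<le> 1" using S1[of N] by (simp add: S_def[of 0])
    finally show ?thesis .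
  qed
  ultimately have "summable (\<lambda>n. (a n)\<^sup>2)"
    by (intro summableI_nonneg_bounded[where x = 1]) (auto intro: order_trans)
  then have "summable (\<lambda>n. a n * b n)" using a0 prod by blast
  moreover have "(0::real) < 1 / 2" by simp
  ultimately obtain m where m: "\<And>n. norm (\<Sum>k=m..<n. a k * b k) < 1 / 2"
    unfolding summable_Cauchy by blast
  \<comment> \<open>On a tail the products sum to less than 1/2, while they dominate
    \<open>(b k)\<^sup>2 / S n\<close>; hence \<open>S n - S m\<close> is at most half of
    \<open>S n\<close>.\<close>
  have Sle: "S n \<le> 2 * S m" for n
  proof (cases "m \<le> n")
    case False
    then have "S n \<le> S m" unfolding S_def by (intro add_left_mono sum_mono2) auto
    then show ?thesis using S1[of m] by linarith
  next
    case True
    have pn: "0 < S n" using S1[of n] by linarith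
    have "(b k)\<^sup>2 / S n \<le> a k * b k" if "k \<in> {m..<n}" for k
    proof -
      have "S (Suc k) \<le> S n" using that unfolding S_def by (intro add_left_mono sum_mono2) auto
      then have "(b k)\<^sup>2 / S n \<le> (b k)\<^sup>2 / S (Suc k)"
        using S1[of "Suc k"] pn by (intro divide_left_mono) auto
      then show ?thesis by (simp add: a_def power2_eq_square)
    qed
    then have "(\<Sum>k=m..<n. (b k)\<^sup>2) / S n \<le> (\<Sum>k=m..<n. a k * b k)"
      unfolding sum_divide_distrib by (rule sum_mono)
    also have "\<dots> < 1 / 2" using m[of n] by simp
    finally have "(\<Sum>k=m..<n. (b k)\<^sup>2) \<le> S n / 2" using pn by (simp add: pos_divide_less_eq)
    moreover have "S n = S m + (\<Sum>k=m..<n. (b k)\<^sup>2)"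
    proof -
      have "(\<Sum>k<n. (b k)\<^sup>2) = (\<Sum>k<m. (b k)\<^sup>2) + (\<Sum>k=m..<n. (b k)\<^sup>2)"
        using sum.atLeastLessThan_concat[of 0 m n "\<lambda>k. (b k)\<^sup>2"] True by (simp add: lessThan_atLeast0)
      then show ?thesis by (simp add: S_def)
    qed
    ultimately show ?thesis by linarith
  qed
  have "(\<Sum>k<n. (b k)\<^sup>2) \<le> 2 * S m" for n
    using Sle[of n] S_def[of n] by linarith
  then show ?thesis by (intro summableI_nonneg_bounded[where x = "2 * S m"]) auto
qed

context interpolating
begin

text \<open>\<open>K\<close> and \<open>b\<close> are chosen before the multiplier \<open>m\<close>,
  so one difference serves both the preimages (\<open>m = 1\<close>) and their images
  (\<open>m = \<mu>\<close>), in norm and pointwise.\<close>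

lemma rat_diff_mult:
  "\<exists>K b. (\<forall>m. comb N (\<lambda>n. c n * m n) - comb N' (\<lambda>n. c' n * m n) = comb K (\<lambda>n. b n * m n)) \<and>
    (\<forall>m z. rat N (\<lambda>n. c n * m n) z - rat N' (\<lambda>n. c' n * m n) z = rat K (\<lambda>n. b n * m n) z)"
proof -
  define K where "K = max N N'"
  define b where "b n = (if n < N then c n else 0) - (if n < N' then c' n else 0)" for n
  have "comb N (\<lambda>n. c n * m n) - comb N' (\<lambda>n. c' n * m n) = comb K (\<lambda>n. b n * m n)" for m
    unfolding comb_mono[of N K, OF max.cobounded1[of N N', folded K_def]]
      comb_mono[of N' K, OF max.cobounded2[of N' N, folded K_def]] comb_diff_same
    unfolding comb_def by (intro sum.cong) (auto simp: b_def algebra_simps)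
  moreover have "rat N (\<lambda>n. c n * m n) z - rat N' (\<lambda>n. c' n * m n) z = rat K (\<lambda>n. b n * m n) z" for m z
  proof -
    have ext: "rat N d z = rat K (\<lambda>n. if n < N then d n else 0) z" if "N \<le> K" for N d
      unfolding rat_def using that by (intro sum.mono_neutral_cong_left) auto
    show ?thesis
      unfolding ext[of N, OF max.cobounded1[of N N', folded K_def]]
        ext[of N', OF max.cobounded2[of N' N, folded K_def]]
      unfolding rat_def sum_subtractf[symmetric]
      by (intro sum.cong) (auto simp: b_def diff_divide_distrib algebra_simps)
  qed
  ultimately show ?thesis by blast
qed

end

section \<open>Description of the range by kernel combinations\<close>

locale bounded_tto = interpolating +
  fixes h :: "complex \<Rightarrow> complex"
  assumes h: "h \<in> H2" and bounded: "tto_bounded (blaschke_prod lam) h"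
begin

definition \<mu> :: "nat \<Rightarrow> complex" where "\<mu> n = cnj (h (lam n))"

lemma tto_comb_bound:
  "\<exists>C. \<forall>N c. norm (comb N (\<lambda>n. c n * \<mu> n)) \<le> C * norm (comb N c)"
proof -
  obtain C where C: "\<And>f g. tto_graph I h f g \<Longrightarrow> h2_norm g \<le> C * h2_norm f"
    using bounded unfolding tto_bounded_def by blast
  have "norm (comb N (\<lambda>n. c n * \<mu> n)) \<le> C * norm (comb N c)" for N c
    using C[OF tto_graph_comb[OF h, of N c]] by (simp add: h2_norm_eq ev_in_H2 \<mu>_def)
  then show ?thesis by blast
qed

lemma Cauchy_tto_comb:
  assumes "Cauchy (\<lambda>m. comb (N m) (c m))"
  shows "Cauchy (\<lambda>m. comb (N m) (\<lambda>n. c m n * \<mu> n))"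
proof -
  obtain C where C: "\<And>N c. norm (comb N (\<lambda>n. c n * \<mu> n)) \<le> C * norm (comb N c)"
    using tto_comb_bound by blast
  have "norm (comb (N m) (\<lambda>n. c m n * \<mu> n) - comb (N k) (\<lambda>n. c k n * \<mu> n))
      \<le> C * norm (comb (N m) (c m) - comb (N k) (c k))" for m k
  proof -
    obtain K b where Kb: "\<And>d. comb (N m) (\<lambda>n. c m n * d n) - comb (N k) (\<lambda>n. c k n * d n) = comb K (\<lambda>n. b n * d n)"
      using rat_diff_mult[of "N m" "c m" "N k" "c k"] by blast
    show ?thesis using C[of K b] Kb[of \<mu>] Kb[of "\<lambda>_. 1"] by simp
  qed
  then show ?thesis by (rule Cauchy_of_norm_diff_le[OF assms])
qed

text \<open>The kernel at \<open>lam k\<close> belongs to the model space, so it may be inserted as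
  test function in the relation defining \<open>g\<close>.\<close>

lemma tto_graph_value:
  assumes "tto_graph I h f g"
  shows "g (lam k) = sample (taylor h) (lam k) (taylor f)"
proof -
  have fg: "f \<in> H2" "g \<in> H2" using assms by (simp_all add: tto_graph_def model_space_iff)
  have "h2_inner g (ev (ker (lam k))) = (\<Sum>n. conjmult_coeff h f n * cnj (tcoeff (ev (ker (lam k))) n))"
    using assms ker_in_mspace[of k] unfolding tto_graph_def by (simp add: ev_in_model_space)
  then show ?thesis
    by (simp add: h2_inner_eq[OF fg(2) ev_in_H2] cinner_ker lam ev_taylor fg conjmult_coeff_eq[OF h]
        seq_ker sample_def)
qed

text \<open>The limit of the images of kernel combinations and the given \<open>g\<close> both lie
  in the model space, and continuity of \<open>sample\<close> gives them equal values at all zeros;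
  so they coincide.\<close>

lemma tto_range_approx:
  assumes g: "g \<in> tto_range I h"
  shows "\<exists>N c u. (\<lambda>m. comb (N m) (c m)) \<longlonglongrightarrow> u \<and> (\<lambda>m. comb (N m) (\<lambda>n. c m n * \<mu> n)) \<longlonglongrightarrow> taylor g"
proof -
  obtain f fs gs where gH: "g \<in> H2" and f: "f \<in> model_space I"
    and graph: "\<And>m. tto_graph I h (fs m) (gs m)"
    and fl: "(\<lambda>m. h2_norm (\<lambda>z. fs m z - f z)) \<longlonglongrightarrow> 0"
    and gl: "(\<lambda>m. h2_norm (\<lambda>z. gs m z - g z)) \<longlonglongrightarrow> 0"
    using g unfolding tto_range_def by blast
  have H: "f \<in> H2" "fs m \<in> H2" "gs m \<in> H2" "taylor f \<in> mspace" "taylor (gs m) \<in> mspace" for m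
    using f graph[of m] by (simp_all add: tto_graph_def model_space_iff)
  have fl': "(\<lambda>m. taylor (fs m)) \<longlonglongrightarrow> taylor f"
    using fl unfolding h2_norm_eq[OF H2_diff(1)[OF H(2,1)]] H2_diff(2)[OF H(2,1)]
    by (rule LIM_zero_cancel[OF tendsto_norm_zero_cancel])
  have gl': "(\<lambda>m. taylor (gs m)) \<longlonglongrightarrow> taylor g"
    using gl unfolding h2_norm_eq[OF H2_diff(1)[OF H(3) gH]] H2_diff(2)[OF H(3) gH]
    by (rule LIM_zero_cancel[OF tendsto_norm_zero_cancel])
  have gm: "taylor g \<in> mspace" by (rule mspace_limit[OF H(5) gl'])
  have gval: "g (lam k) = sample (taylor h) (lam k) (taylor f)" for k
  proof (rule LIMSEQ_unique)
    show "(\<lambda>m. gs m (lam k)) \<longlonglongrightarrow> g (lam k)"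
      using tendsto_ev[OF gl' lam] by (simp add: ev_taylor H gH lam)
    show "(\<lambda>m. gs m (lam k)) \<longlonglongrightarrow> sample (taylor h) (lam k) (taylor f)"
      unfolding tto_graph_value[OF graph] by (rule tendsto_sample[OF fl' lam])
  qed
  obtain N c where p: "(\<lambda>m. comb (N m) (c m)) \<longlonglongrightarrow> taylor f"
    using combs_dense[OF H(4)] by metis
  have "Cauchy (\<lambda>m. comb (N m) (\<lambda>n. c m n * \<mu> n))"
    by (rule Cauchy_tto_comb[OF LIMSEQ_imp_Cauchy[OF p]])
  then obtain w where w: "(\<lambda>m. comb (N m) (\<lambda>n. c m n * \<mu> n)) \<longlonglongrightarrow> w"
    using Cauchy_convergent convergent_def by metis
  have wm: "w \<in> mspace" by (rule mspace_limit[OF comb_in_mspace w])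
  have "ev w (lam k) = g (lam k)" for k
    unfolding gval
  proof (rule LIMSEQ_unique)
    show "(\<lambda>m. ev (comb (N m) (\<lambda>n. c m n * \<mu> n)) (lam k)) \<longlonglongrightarrow> ev w (lam k)"
      by (rule tendsto_ev[OF w lam])
    have "ev (comb (N m) (\<lambda>n. c m n * \<mu> n)) (lam k) = sample (taylor h) (lam k) (comb (N m) (c m))" for m
      using tto_graph_value[OF tto_graph_comb[OF h, of "N m" "c m"], of k] by (simp add: \<mu>_def)
    then show "(\<lambda>m. ev (comb (N m) (\<lambda>n. c m n * \<mu> n)) (lam k)) \<longlonglongrightarrow> sample (taylor h) (lam k) (taylor f)"
      using tendsto_sample[OF p lam] by simp
  qed
  then have "w - taylor g = 0"
    by (intro mspace_eq_0I mspace_diff wm gm) (simp add: ev_diff lam ev_taylor[OF gH])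
  then show ?thesis using p w by auto
qed

text \<open>The source of test functions for the converse: combinations are bounded, hence
  admissible approximants.\<close>

lemma tto_range_of_limit:
  assumes "(\<lambda>m. comb (N m) (c m)) \<longlonglongrightarrow> u" "(\<lambda>m. comb (N m) (\<lambda>n. c m n * \<mu> n)) \<longlonglongrightarrow> w"
  shows "ev w \<in> tto_range I h"
  unfolding tto_range_def
proof (intro CollectI conjI exI allI)
  show "ev w \<in> H2" by (rule ev_in_H2)
  show "ev u \<in> model_space I"
    using mspace_limit[OF comb_in_mspace assms(1)] by (simp add: ev_in_model_space)
  show "tto_graph I h (ev (comb (N m) (c m))) (ev (comb (N m) (\<lambda>n. c m n * \<mu> n)))" for m
    unfolding \<mu>_def by (rule tto_graph_comb[OF h])
  show "(\<lambda>m. h2_norm (\<lambda>z. ev (comb (N m) (c m)) z - ev u z)) \<longlonglongrightarrow> 0"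
    using tendsto_norm_zero[OF LIM_zero[OF assms(1)]]
    by (simp add: h2_norm_eq[OF H2_diff(1)[OF ev_in_H2 ev_in_H2]] H2_diff(2)[OF ev_in_H2 ev_in_H2])
  show "(\<lambda>m. h2_norm (\<lambda>z. ev (comb (N m) (\<lambda>n. c m n * \<mu> n)) z - ev w z)) \<longlonglongrightarrow> 0"
    using tendsto_norm_zero[OF LIM_zero[OF assms(2)]]
    by (simp add: h2_norm_eq[OF H2_diff(1)[OF ev_in_H2 ev_in_H2]] H2_diff(2)[OF ev_in_H2 ev_in_H2])
qed

end

section \<open>Boundary behaviour\<close>

context bounded_tto
begin

context
  fixes \<zeta> :: complex
  assumes \<zeta>: "cmod \<zeta> = 1"
begin

lemma zeta_minus_lam: "cmod (\<zeta> - lam n) = cmod (1 - cnj (lam n) * \<zeta>)" "\<zeta> - lam n \<noteq> 0"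
proof -
  have "\<zeta> * cnj \<zeta> = 1" using \<zeta> by (metis complex_norm_square of_real_1 one_power2)
  then have "\<zeta> - lam n = \<zeta> * cnj (1 - cnj (lam n) * \<zeta>)" by (simp add: algebra_simps)
  then have "cmod (\<zeta> - lam n) = cmod \<zeta> * cmod (1 - cnj (lam n) * \<zeta>)"
    by (metis complex_mod_cnj norm_mult)
  then show "cmod (\<zeta> - lam n) = cmod (1 - cnj (lam n) * \<zeta>)" using \<zeta> by simp
  show "\<zeta> - lam n \<noteq> 0" using \<zeta> lam[of n] by auto
qed

text \<open>The modulus at \<zeta> of the diagonal image of the \<open>n\<close>-th unit
  kernel.\<close>

definition q :: "nat \<Rightarrow> real" where "q n = s n * cmod (h (lam n)) / cmod (\<zeta> - lam n)"

lemma q_nonneg: "0 \<le> q n"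
  using s_pos[of n] by (simp add: q_def)

lemma q_square: "(q n)\<^sup>2 = (1 - (cmod (lam n))\<^sup>2) * (cmod (h (lam n) / (\<zeta> - lam n)))\<^sup>2"
proof -
  have "(s n)\<^sup>2 = 1 - (cmod (lam n))\<^sup>2"
    using lam[of n] by (simp add: s_def cmod_square_le_1 less_imp_le)
  then show ?thesis by (simp add: q_def power_mult_distrib power_divide norm_divide)
qed

text \<open>\<open>\<beta>\<close> compares the denominators at \<open>z\<close> with those at
  \<zeta>: it is 1 at \<zeta> itself and \<open>\<alpha> + 1\<close> on a Stolz angle. The
  hypothesis \<open>M\<close> is the lower Riesz bound, trading coefficients for the norm of the
  preimage.\<close>

lemma cmod_rat_le:
  assumes S: "summable (\<lambda>n. (q n)\<^sup>2)" and z: "cmod z \<le> 1" and \<beta>: "0 \<le> \<beta>"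
    and le: "\<And>n. cmod (\<zeta> - lam n) \<le> \<beta> * cmod (1 - cnj (lam n) * z)"
    and M0: "0 \<le> M"
    and M: "(\<Sum>n<N. (cmod (c n))\<^sup>2) \<le> M * (norm (comb N c))\<^sup>2"
  shows "cmod (rat N (\<lambda>n. c n * \<mu> n) z) \<le> \<beta> * sqrt (M * (\<Sum>n. (q n)\<^sup>2)) * norm (comb N c)"
proof -
  define T where "T = (\<Sum>n<N. cmod (c n) * q n)"
  have T0: "0 \<le> T" unfolding T_def by (intro sum_nonneg mult_nonneg_nonneg q_nonneg) simp
  have "cmod (c n * \<mu> n * of_real (s n) / (1 - cnj (lam n) * z)) \<le> \<beta> * (cmod (c n) * q n)" for n
  proof -
    define y where "y = cmod (1 - cnj (lam n) * z)"
    have y: "0 < y" using one_minus_cnj_mult_nonzero[OF lam z, of n] by (simp add: y_def)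
    have w: "0 < cmod (\<zeta> - lam n)" using zeta_minus_lam(2)[of n] by simp
    have "cmod (\<zeta> - lam n) \<le> \<beta> * y" using le[of n] by (simp add: y_def)
    then have "1 / y \<le> \<beta> / cmod (\<zeta> - lam n)" using y w by (simp add: field_simps)
    then have "(cmod (c n) * (s n * cmod (h (lam n)))) * (1 / y) \<le> (cmod (c n) * (s n * cmod (h (lam n)))) * (\<beta> / cmod (\<zeta> - lam n))"
      using s_pos[of n] by (intro mult_left_mono) auto
    then show ?thesis
      using s_pos[of n] by (simp add: norm_mult norm_divide \<mu>_def y_def q_def mult_ac)
  qed
  then have "cmod (rat N (\<lambda>n. c n * \<mu> n) z) \<le> \<beta> * T"
    unfolding rat_def T_def sum_distrib_left by (intro order_trans[OF norm_sum] sum_mono)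
  also have "T \<le> sqrt (M * (\<Sum>n. (q n)\<^sup>2)) * norm (comb N c)"
  proof (rule power2_le_imp_le)
    have "T\<^sup>2 \<le> (\<Sum>n<N. (cmod (c n))\<^sup>2) * (\<Sum>n<N. (q n)\<^sup>2)"
      unfolding T_def by (rule Cauchy_Schwarz_ineq_sum)
    also have "\<dots> \<le> (M * (norm (comb N c))\<^sup>2) * (\<Sum>n. (q n)\<^sup>2)"
      using M sum_le_suminf[OF S, of "{..<N}"] M0 by (intro mult_mono) (auto intro: sum_nonneg)
    also have "\<dots> = (sqrt (M * (\<Sum>n. (q n)\<^sup>2)) * norm (comb N c))\<^sup>2"
      using M0 suminf_nonneg[OF S] by (simp add: power_mult_distrib)
    finally show "T\<^sup>2 \<le> (sqrt (M * (\<Sum>n. (q n)\<^sup>2)) * norm (comb N c))\<^sup>2" .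
    show "0 \<le> sqrt (M * (\<Sum>n. (q n)\<^sup>2)) * norm (comb N c)"
      using M0 suminf_nonneg[OF S] by simp
  qed
  finally show ?thesis using \<beta> by (simp add: mult_left_mono mult.assoc)
qed

lemma continuous_rat: "isCont (rat N c) \<zeta>"
  unfolding rat_def using one_minus_cnj_mult_nonzero[OF lam, of \<zeta>] \<zeta>
  by (intro continuous_intros) auto

text \<open>The rational approximants are continuous at \<zeta> and converge uniformly on each Stolz
  angle, so the limits may be interchanged. The limit \<open>L\<close> of their values at \<zeta>
  does not depend on the aperture.\<close>

lemma nt_limit_if_summable:
  assumes S: "summable (\<lambda>n. (q n)\<^sup>2)" and g: "g \<in> tto_range I h"
  shows "has_nt_limit g \<zeta>"
proof -
  obtain M where M0: "M \<ge> 0" and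
    "\<And>N a. (norm (\<Sum>n<N. cscale (a n) (x n)))\<^sup>2 \<le> M * (\<Sum>n<N. (cmod (a n))\<^sup>2)" and
    M: "\<And>N a. (\<Sum>n<N. (cmod (a n))\<^sup>2) \<le> M * (norm (\<Sum>n<N. cscale (a n) (x n)))\<^sup>2"
    by (fact riesz_bounds)
  define D where "D = sqrt (M * (\<Sum>n. (q n)\<^sup>2))"
  have gH: "g \<in> H2" using g by (simp add: tto_range_def)
  obtain N c u where p: "(\<lambda>m. comb (N m) (c m)) \<longlonglongrightarrow> u"
    and w: "(\<lambda>m. comb (N m) (\<lambda>n. c m n * \<mu> n)) \<longlonglongrightarrow> taylor g"
    using tto_range_approx[OF g] by blast
  define R where "R m = rat (N m) (\<lambda>n. c m n * \<mu> n)" for m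
  have diff: "cmod (R m z - R k z) \<le> \<beta> * D * norm (comb (N m) (c m) - comb (N k) (c k))"
    if z: "cmod z \<le> 1" and \<beta>: "0 \<le> \<beta>" "\<And>n. cmod (\<zeta> - lam n) \<le> \<beta> * cmod (1 - cnj (lam n) * z)" for m k z \<beta>
  proof -
    obtain K b where Kb: "\<And>d. comb (N m) (\<lambda>n. c m n * d n) - comb (N k) (\<lambda>n. c k n * d n) = comb K (\<lambda>n. b n * d n)"
      "\<And>d z. rat (N m) (\<lambda>n. c m n * d n) z - rat (N k) (\<lambda>n. c k n * d n) z = rat K (\<lambda>n. b n * d n) z"
      using rat_diff_mult[of "N m" "c m" "N k" "c k"] by blast
    have "cmod (rat K (\<lambda>n. b n * \<mu> n) z) \<le> \<beta> * D * norm (comb K b)"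
      unfolding D_def by (rule cmod_rat_le[OF S z \<beta> M0 M[of b K, folded comb_def]])
    then show ?thesis
      unfolding R_def Kb(2) using Kb(1)[of "\<lambda>_. 1"] by simp
  qed
  have "cmod (R m \<zeta> - R k \<zeta>) \<le> 1 * D * norm (comb (N m) (c m) - comb (N k) (c k))" for m k
    by (rule diff) (use \<zeta> in \<open>auto simp: zeta_minus_lam(1)\<close>)
  from Cauchy_of_norm_diff_le[OF LIMSEQ_imp_Cauchy[OF p] this]
  obtain L where L: "(\<lambda>m. R m \<zeta>) \<longlonglongrightarrow> L"
    using Cauchy_convergent convergent_def by metis
  have "(g \<longlongrightarrow> L) (at \<zeta> within stolz \<zeta> \<alpha>)" if \<alpha>: "\<alpha> > 1" for \<alpha>
  proof (rule swap_uniform_limit)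
    show "\<forall>\<^sub>F m in sequentially. (R m \<longlongrightarrow> R m \<zeta>) (at \<zeta> within stolz \<zeta> \<alpha>)"
      unfolding R_def
      by (rule always_eventually, rule allI,
          rule tendsto_within_subset[OF continuous_rat[unfolded isCont_def] subset_UNIV])
    show "(\<lambda>m. R m \<zeta>) \<longlonglongrightarrow> L" by (rule L)
    show "uniform_limit (stolz \<zeta> \<alpha>) R g sequentially"
    proof (rule uniform_limitI)
      fix e :: real assume e: "e > 0"
      have near: "cmod (R m z - g z) \<le> (\<alpha> + 1) * D * norm (comb (N m) (c m) - u)" if z: "z \<in> stolz \<zeta> \<alpha>" for m z
      proof (rule LIMSEQ_le)
        have z1: "cmod z < 1" "cmod (z - \<zeta>) < \<alpha> * (1 - cmod z)" using z by (auto simp: stolz_def)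
        \<comment> \<open>Going from \<zeta> to \<open>lam n\<close> through \<open>z\<close>, the
          first leg is below \<open>\<alpha> * (1 - cmod z)\<close> and the second is at most the
          denominator because Moebius factors have modulus at most 1.\<close>
        have le: "cmod (\<zeta> - lam n) \<le> (\<alpha> + 1) * cmod (1 - cnj (lam n) * z)" for n
        proof -
          have "cmod (z - lam n) \<le> cmod (1 - cnj (lam n) * z)"
          proof (rule power2_le_imp_le)
            have "0 \<le> (1 - (cmod (lam n))\<^sup>2) * (1 - (cmod z)\<^sup>2)"
              using lam[of n] z1(1) by (simp add: cmod_square_le_1 less_imp_le)
            then show "(cmod (z - lam n))\<^sup>2 \<le> (cmod (1 - cnj (lam n) * z))\<^sup>2"
              unfolding cmod_one_minus_sub[symmetric] norm_minus_commute[of z] by linarith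
          qed simp
          moreover have "\<alpha> * (1 - cmod z) \<le> \<alpha> * cmod (1 - cnj (lam n) * z)"
            using one_minus_cmod_le(2)[of "lam n" z] lam[of n] z1 \<alpha> by (intro mult_left_mono) auto
          moreover have "cmod (\<zeta> - lam n) \<le> cmod (z - \<zeta>) + cmod (z - lam n)"
            using norm_triangle_ineq[of "\<zeta> - z" "z - lam n"] by (simp add: norm_minus_commute)
          ultimately show ?thesis using z1(2) by (simp add: distrib_right)
        qed
        have "(\<lambda>k. R k z) \<longlonglongrightarrow> g z"
          using tendsto_ev[OF w z1(1)] by (simp add: R_def ev_comb[OF z1(1)] ev_taylor[OF gH z1(1)])
        then show "(\<lambda>k. cmod (R m z - R k z)) \<longlonglongrightarrow> cmod (R m z - g z)"
          by (intro tendsto_intros)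
        show "(\<lambda>k. (\<alpha> + 1) * D * norm (comb (N m) (c m) - comb (N k) (c k))) \<longlonglongrightarrow> (\<alpha> + 1) * D * norm (comb (N m) (c m) - u)"
          by (intro tendsto_intros p)
        show "\<exists>K. \<forall>k\<ge>K. cmod (R m z - R k z) \<le> (\<alpha> + 1) * D * norm (comb (N m) (c m) - comb (N k) (c k))"
          using diff[of z "\<alpha> + 1"] le z1 \<alpha> by auto
      qed
      have "(\<lambda>m. (\<alpha> + 1) * D * norm (comb (N m) (c m) - u)) \<longlonglongrightarrow> 0"
        using tendsto_mult_right_zero[OF tendsto_norm_zero[OF LIM_zero[OF p]]] .
      from order_tendstoD(2)[OF this e]
      show "\<forall>\<^sub>F m in sequentially. \<forall>z\<in>stolz \<zeta> \<alpha>. dist (R m z) (g z) < e"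
        by eventually_elim (use near in \<open>auto simp: dist_norm intro: le_less_trans\<close>)
    qed
  qed simp
  then show ?thesis unfolding has_nt_limit_def by blast
qed

section \<open>Necessity of the summability condition\<close>

lemma norm_cnj_lam_zeta: "cmod (cnj (lam n) * \<zeta>) < 1"
  using lam[of n] \<zeta> by (simp add: norm_mult)

lemma radial_nz: "0 \<le> r \<Longrightarrow> r \<le> 1 \<Longrightarrow> 1 - of_real r * (cnj (lam n) * \<zeta>) \<noteq> 0"
proof
  assume r: "0 \<le> r" "r \<le> 1" and eq: "1 - of_real r * (cnj (lam n) * \<zeta>) = 0"
  then have "cmod (of_real r * (cnj (lam n) * \<zeta>)) = 1" by simp
  moreover have "cmod (of_real r * (cnj (lam n) * \<zeta>)) \<le> cmod (cnj (lam n) * \<zeta>)"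
    unfolding norm_mult[of "of_real r"] norm_of_real using r by (intro mult_left_le_one_le) auto
  ultimately show False using norm_cnj_lam_zeta[of n] by linarith
qed

text \<open>The unimodular factors of the coefficients are chosen so that all terms of the series for
  \<open>\<pi>\<close> of the boundary function along the radius have the same sign.\<close>

lemma summable_signed_part:
  fixes a \<sigma> :: "nat \<Rightarrow> real" and \<pi> :: "complex \<Rightarrow> real"
  assumes nt: "\<And>g. g \<in> tto_range I h \<Longrightarrow> has_nt_limit g \<zeta>"
    and a: "\<And>n. 0 \<le> a n" "summable (\<lambda>n. (a n)\<^sup>2)"
    and \<sigma>: "\<And>n. \<bar>\<sigma> n\<bar> = 1"
    and \<pi>: "bounded_linear \<pi>" "\<And>z. \<bar>\<pi> z\<bar> \<le> cmod z"
    and pos: "\<And>n r. 0 < r \<Longrightarrow> r \<le> 1 \<Longrightarrow> 0 \<le> \<sigma> n * \<pi> (inverse (1 - of_real r * (cnj (lam n) * \<zeta>)))"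
  shows "summable (\<lambda>n. a n * (s n * cmod (h (lam n))) * (\<sigma> n * \<pi> (inverse (1 - cnj (lam n) * \<zeta>))))"
proof -
  \<comment> \<open>The factor \<open>sgn (h (lam n))\<close> cancels the phase of
    \<open>\<mu> n\<close>, leaving a real coefficient with sign \<open>\<sigma> n\<close>.\<close>
  define b where "b n = of_real (\<sigma> n * a n) * sgn (h (lam n))" for n
  have b\<mu>: "b n * \<mu> n = of_real (\<sigma> n * a n * cmod (h (lam n)))" for n
  proof -
    have "sgn (h (lam n)) * cnj (h (lam n)) = of_real (cmod (h (lam n)))"
    proof (cases "h (lam n) = 0")
      case False
      have "sgn (h (lam n)) * cnj (h (lam n)) = of_real ((cmod (h (lam n)))\<^sup>2) / of_real (cmod (h (lam n)))"
        by (simp only: sgn_eq complex_norm_square times_divide_eq_left)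
      then show ?thesis using False by (simp add: power2_eq_square)
    qed simp
    then show ?thesis by (simp add: b_def \<mu>_def mult.assoc)
  qed
  have "cmod (b n) \<le> a n" for n
    using a(1)[of n] \<sigma>[of n] by (simp add: b_def norm_mult abs_mult norm_sgn)
  then have "(cmod (b n))\<^sup>2 \<le> (a n)\<^sup>2" for n by (rule power_mono) simp
  then have "summable (\<lambda>n. (cmod (b n))\<^sup>2)"
    by (intro summable_comparison_test'[where N = 0, OF a(2)]) simp
  from convergent_unit_ker_series[OF this]
  obtain u where u: "(\<lambda>N. comb N b) \<longlonglongrightarrow> u" unfolding convergent_def comb_def by blast
  have "Cauchy (\<lambda>N. comb N (\<lambda>n. b n * \<mu> n))"
    using Cauchy_tto_comb[of "\<lambda>m. m" "\<lambda>_. b"] LIMSEQ_imp_Cauchy[OF u] by simp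
  then obtain w where w: "(\<lambda>N. comb N (\<lambda>n. b n * \<mu> n)) \<longlonglongrightarrow> w"
    using Cauchy_convergent convergent_def by metis
  have "ev w \<in> tto_range I h"
    using tto_range_of_limit[of "\<lambda>m. m" "\<lambda>_. b"] u w by simp
  \<comment> \<open>On the radius \<open>cmod (z - \<zeta>)\<close> equals
    \<open>1 - cmod z\<close>, so any aperture above 1 contains it; 2 is one choice.\<close>
  then obtain L where "(ev w \<longlongrightarrow> L) (at \<zeta> within stolz \<zeta> 2)"
    using nt unfolding has_nt_limit_def by force
  from tendstoD[OF this zero_less_one]
  obtain d where d: "d > 0" "\<And>z. z \<in> stolz \<zeta> 2 \<Longrightarrow> z \<noteq> \<zeta> \<Longrightarrow> dist z \<zeta> < d \<Longrightarrow> dist (ev w z) L < 1"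
    unfolding eventually_at by blast
  define B where "B = cmod L + 1"
  define t where "t r n = a n * (s n * cmod (h (lam n))) * (\<sigma> n * \<pi> (inverse (1 - of_real r * (cnj (lam n) * \<zeta>))))" for r n
  have t0: "0 \<le> t r n" if "0 < r" "r \<le> 1" for r n
    unfolding t_def
    by (rule mult_nonneg_nonneg[OF mult_nonneg_nonneg[OF a(1)
          mult_nonneg_nonneg[OF less_imp_le[OF s_pos] norm_ge_zero]] pos[OF that]])
  have part: "(\<Sum>n<N. t r n) \<le> B" if r: "max 0 (1 - d) < r" "r < 1" for r N
  proof -
    define z where "z = of_real r * \<zeta>"
    have r0: "0 < r" using r by simp
    have zr: "cmod z = r" using \<zeta> r0 by (simp add: z_def norm_mult)
    have "z - \<zeta> = - (of_real (1 - r) * \<zeta>)" by (simp add: z_def algebra_simps)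
    then have zz: "cmod (z - \<zeta>) = 1 - r"
      using \<zeta> r by (simp only: norm_minus_cancel norm_mult norm_of_real) simp
    have "z \<in> stolz \<zeta> 2" using zr zz r by (simp add: stolz_def)
    moreover have "z \<noteq> \<zeta>" using zz r by auto
    moreover have "dist z \<zeta> < d" using zz r by (simp add: dist_norm)
    ultimately have "dist (ev w z) L < 1" by (rule d(2))
    then have wB: "cmod (ev w z) \<le> B"
      using norm_triangle_ineq2[of "ev w z" L] by (simp add: B_def dist_norm)
    have z1: "cmod z < 1" using zr r by simp
    have "\<pi> (ev (comb N (\<lambda>n. b n * \<mu> n)) z) = (\<Sum>n<N. t r n)" for N
    proof -
      have "\<pi> (ev (comb N (\<lambda>n. b n * \<mu> n)) z)
          = \<pi> (\<Sum>n<N. (\<sigma> n * a n * cmod (h (lam n)) * s n) *\<^sub>R inverse (1 - of_real r * (cnj (lam n) * \<zeta>)))"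
        unfolding ev_comb[OF z1] rat_def b\<mu>
        by (intro arg_cong[where f = \<pi>] sum.cong refl)
          (simp add: scaleR_conv_of_real divide_inverse z_def mult_ac)
      also have "\<dots> = (\<Sum>n<N. t r n)"
        by (simp add: linear_sum[OF bounded_linear.linear[OF \<pi>(1)]] linear_cmul[OF bounded_linear.linear[OF \<pi>(1)]]
            t_def mult_ac)
      finally show ?thesis .
    qed
    then have "(\<lambda>N. \<Sum>n<N. t r n) \<longlonglongrightarrow> \<pi> (ev w z)"
      using bounded_linear.tendsto[OF \<pi>(1) tendsto_ev[OF w z1]] by simp
    moreover have "incseq (\<lambda>N. \<Sum>n<N. t r n)"
      using t0[of r] r0 r by (intro incseq_SucI) simp
    ultimately have "(\<Sum>n<N. t r n) \<le> \<pi> (ev w z)" by (rule incseq_le[rotated])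
    also have "\<dots> \<le> B" using \<pi>(2)[of "ev w z"] wB by linarith
    finally show ?thesis .
  qed
  \<comment> \<open>For fixed \<open>N\<close> the sum is continuous in \<open>r\<close> up to the
    endpoint, and the bound \<open>B\<close> depends on neither \<open>r\<close> nor
    \<open>N\<close>.\<close>
  have "(\<Sum>n<N. t 1 n) \<le> B" for N
  proof (rule tendsto_upperbound)
    show "((\<lambda>r. \<Sum>n<N. t r n) \<longlongrightarrow> (\<Sum>n<N. t 1 n)) (at_left 1)"
      unfolding t_def using radial_nz[of 1]
      by (intro tendsto_intros bounded_linear.tendsto[OF \<pi>(1)]) auto
    have "\<forall>\<^sub>F r in at_left (1::real). r \<in> {max 0 (1 - d) <..< 1}"
      by (rule eventually_at_left_real) (use d in auto)
    then show "\<forall>\<^sub>F r in at_left 1. (\<Sum>n<N. t r n) \<le> B"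
      by eventually_elim (use part in auto)
  qed simp
  then have "summable (t 1)"
    using t0[of 1] by (intro summableI_nonneg_bounded[where x = B]) auto
  then show ?thesis by (simp add: t_def[abs_def])
qed

text \<open>For |w| < 1 and 0 < r <= 1, the inverse of 1 - r w has nonnegative real part and an
  imaginary part whose sign is that of Im w, independent of r. Two applications of
  \<open>summable_signed_part\<close> therefore suffice, as the modulus is at most the sum of the
  absolute values of both parts.\<close>

lemma summable_if_nt_limit:
  assumes nt: "\<And>g. g \<in> tto_range I h \<Longrightarrow> has_nt_limit g \<zeta>"
  shows "summable (\<lambda>n. (q n)\<^sup>2)"
proof (rule square_summable_of_products[OF q_nonneg])
  fix a :: "nat \<Rightarrow> real" assume a: "\<And>n. 0 \<le> a n" "summable (\<lambda>n. (a n)\<^sup>2)"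
  define w where "w n = cnj (lam n) * \<zeta>" for n
  define k where "k n = a n * (s n * cmod (h (lam n)))" for n
  have k0: "0 \<le> k n" for n using a(1)[of n] s_pos[of n] by (simp add: k_def)
  define \<sigma> :: "nat \<Rightarrow> real" where "\<sigma> n = (if 0 \<le> Im (w n) then 1 else -1)" for n
  have Re0: "0 \<le> Re (inverse (1 - of_real r * w n))" if "0 < r" "r \<le> 1" for r n
  proof -
    have "Re (of_real r * w n) \<le> cmod (of_real r * w n)" by (rule complex_Re_le_cmod)
    also have "\<dots> \<le> 1"
      using norm_cnj_lam_zeta[of n] that mult_left_le_one_le[of "cmod (w n)" r]
      unfolding norm_mult by (simp add: w_def norm_mult)
    finally show ?thesis by (simp add: inverse_complex.sel)
  qed
  have Im0: "0 \<le> \<sigma> n * Im (inverse (1 - of_real r * w n))" if "0 < r" "r \<le> 1" for r n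
  proof -
    have "0 \<le> \<sigma> n * Im (w n)" by (simp add: \<sigma>_def)
    then have "0 \<le> r * (\<sigma> n * Im (w n)) / (cmod (1 - of_real r * w n))\<^sup>2"
      using that by (intro divide_nonneg_nonneg mult_nonneg_nonneg[of r]) auto
    moreover have inv: "Im (inverse v) = - Im v / (cmod v)\<^sup>2" for v
      by (simp add: inverse_complex.sel cmod_power2)
    have "r * (\<sigma> n * Im (w n)) / (cmod (1 - of_real r * w n))\<^sup>2 = \<sigma> n * Im (inverse (1 - of_real r * w n))"
      unfolding inv by simp
    ultimately show ?thesis by linarith
  qed
  have R: "summable (\<lambda>n. k n * (1 * Re (inverse (1 - w n))))"
    using summable_signed_part[OF nt a, of "\<lambda>_. 1" Re] Re0
    by (simp add: bounded_linear_Re abs_Re_le_cmod k_def w_def)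
  have J: "summable (\<lambda>n. k n * (\<sigma> n * Im (inverse (1 - w n))))"
    using summable_signed_part[OF nt a, of \<sigma> Im] Im0
    by (simp add: bounded_linear_Im abs_Im_le_cmod k_def w_def \<sigma>_def)
  show "summable (\<lambda>n. a n * q n)"
  proof (rule summable_comparison_test'[where N = 0, OF summable_add[OF R J]])
    fix n
    have "cmod (inverse (1 - w n)) \<le> \<bar>Re (inverse (1 - w n))\<bar> + \<bar>Im (inverse (1 - w n))\<bar>"
      by (rule cmod_le)
    also have "\<bar>Im (inverse (1 - w n))\<bar> = \<bar>\<sigma> n * Im (inverse (1 - w n))\<bar>"
      by (simp add: \<sigma>_def)
    also have "\<bar>Re (inverse (1 - w n))\<bar> + \<bar>\<sigma> n * Im (inverse (1 - w n))\<bar>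
        = Re (inverse (1 - w n)) + \<sigma> n * Im (inverse (1 - w n))"
      by (simp only: abs_of_nonneg[OF Re0[of 1 n, OF zero_less_one order_refl, unfolded of_real_1 mult_1]]
          abs_of_nonneg[OF Im0[of 1 n, OF zero_less_one order_refl, unfolded of_real_1 mult_1]])
    finally have "k n * cmod (inverse (1 - w n)) \<le> k n * (Re (inverse (1 - w n)) + \<sigma> n * Im (inverse (1 - w n)))"
      using k0 by (rule mult_left_mono)
    moreover have "a n * q n = k n * cmod (inverse (1 - w n))"
      by (simp add: k_def q_def zeta_minus_lam(1) w_def norm_inverse divide_inverse)
    moreover have "0 \<le> a n * q n" using a(1) q_nonneg by simp
    ultimately show "norm (a n * q n) \<le> k n * (1 * Re (inverse (1 - w n))) + k n * (\<sigma> n * Im (inverse (1 - w n)))"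
      by (simp add: distrib_left)
  qed
qed

end

end

theorem theorem1p9:
  fixes lam :: "nat \<Rightarrow> complex" and h :: "complex \<Rightarrow> complex" and \<zeta> :: complex
  assumes "interpolating_seq lam"
    and "h \<in> H2"
    and "tto_bounded (blaschke_prod lam) h"
    and "cmod \<zeta> = 1"
  shows "(\<forall>g\<in>tto_range (blaschke_prod lam) h. has_nt_limit g \<zeta>) \<longleftrightarrow>
         summable (\<lambda>n. (1 - (cmod (lam n))^2) * (cmod (h (lam n) / (\<zeta> - lam n)))^2)"
proof -
  interpret bounded_tto lam h
    using assms by unfold_locales
  note q2 = q_square[OF assms(4), symmetric]
  show ?thesis
    unfolding q2
  proof (intro iffI ballI)
    assume "\<forall>g\<in>tto_range I h. has_nt_limit g \<zeta>"
    then have "has_nt_limit g \<zeta>" if "g \<in> tto_range I h" for g using that by (rule bspec)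
    then show "summable (\<lambda>n. (q \<zeta> n)\<^sup>2)" by (rule summable_if_nt_limit[OF assms(4)])
  next
    fix g assume "summable (\<lambda>n. (q \<zeta> n)\<^sup>2)" "g \<in> tto_range I h"
    then show "has_nt_limit g \<zeta>" by (rule nt_limit_if_summable[OF assms(4)])
  qed
qed

end
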